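(* Let $D,f_0>0$, $c_*=2\sqrt{Df_0}$ and $\alpha>0$. Let $$A(t)=-\frac{L(t)}{2}=-c_*t+\alpha\log(t+1)+\eta(t),$$ with $L(t)>0$ for all $t\ge0$, where, as $t\to\infty$, $$\eta(t)=O(1),\quad\dot\eta(t)=o(1/t),\quad\ddot\eta(t)=o(1/t^2),\quad\dddot\eta(t)=o(1/t^3).$$ Let $\psi\ge0$, $\psi\not\equiv0$, be a solution of $$\frac{\partial\psi}{\partial t}=D\frac{\partial^2\psi}{\partial x^2}+f_0\psi\ \text{ in } A(t)<x<A(t)+L(t),\qquad\psi=0\ \text{ at } x=A(t)\text{ and }x=A(t)+L(t).$$ Then $$\psi(A(t)+y,t)=\overline{\underline{O}}\Big(y\,t^{-\frac32+\frac{\alpha c_*}{2D}}\Big)\quad\text{as } t\to\infty,\ \text{for } y=O(1);$$ that is, for every $Y>0$ there exist $T>0$ and constants $0<\beta_0\le\beta_1$ such that for all $t\ge T$ and $0\le y\le Y$, $$\beta_0\,y\,t^{-\frac32+\frac{\alpha c_*}{2D}}\le\psi(A(t)+y,t)\le\beta_1\,y\,t^{-\frac32+\frac{\alpha c_*}{2D}}.$$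
   Context: $F_1=\overline{\underline{O}}(F_2)$ ("exactly of the order") means $F_1=O(F_2)$ and $F_2=O(F_1)$ in the limit considered, i.e. there are constants $0<\beta_0\le\beta_1$ with $\beta_0|F_2|\le|F_1|\le\beta_1|F_2|$. The function $\eta$ is assumed sufficiently smooth (three times differentiable, with $A$ and $L$ twice continuously differentiable). Dots denote derivatives with respect to $t$. *)

theory Defs
  imports "HOL-Analysis.Analysis" "HOL-Library.Landau_Symbols"
begin

text \<open>
  Space-time points are written \<open>(x, t)\<close>. Nothing is required at time \<open>t = 0\<close>, so solutions
  with arbitrary (possibly irregular) initial data are covered.
\<close>

definition open_domain :: "(real \<Rightarrow> real) \<Rightarrow> (real \<Rightarrow> real) \<Rightarrow> (real \<times> real) set" where
  "open_domain A L = {(x, t). 0 < t \<and> A t < x \<and> x < A t + L t}"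

definition closed_domain :: "(real \<Rightarrow> real) \<Rightarrow> (real \<Rightarrow> real) \<Rightarrow> (real \<times> real) set" where
  "closed_domain A L = {(x, t). 0 < t \<and> A t \<le> x \<and> x \<le> A t + L t}"

text \<open>
  Classical solution: \<open>C\<^sup>2\<close> in \<open>x\<close> and \<open>C\<^sup>1\<close> in \<open>t\<close> inside the domain, continuous up to the
  lateral boundary, where it vanishes.
\<close>

definition dirichlet_solution ::
  "real \<Rightarrow> real \<Rightarrow> (real \<Rightarrow> real) \<Rightarrow> (real \<Rightarrow> real) \<Rightarrow> (real \<Rightarrow> real \<Rightarrow> real) \<Rightarrow> bool" where
  "dirichlet_solution D f\<^sub>0 A L \<psi> \<longleftrightarrow>
     continuous_on (closed_domain A L) (\<lambda>(x, t). \<psi> x t) \<and>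
     (\<exists>\<psi>\<^sub>t \<psi>\<^sub>x \<psi>\<^sub>x\<^sub>x.
        continuous_on (open_domain A L) (\<lambda>(x, t). \<psi>\<^sub>t x t) \<and>
        continuous_on (open_domain A L) (\<lambda>(x, t). \<psi>\<^sub>x x t) \<and>
        continuous_on (open_domain A L) (\<lambda>(x, t). \<psi>\<^sub>x\<^sub>x x t) \<and>
        (\<forall>(x, t) \<in> open_domain A L.
           ((\<lambda>s. \<psi> x s) has_real_derivative \<psi>\<^sub>t x t) (at t) \<and>
           ((\<lambda>z. \<psi> z t) has_real_derivative \<psi>\<^sub>x x t) (at x) \<and>
           ((\<lambda>z. \<psi>\<^sub>x z t) has_real_derivative \<psi>\<^sub>x\<^sub>x x t) (at x) \<and>
           \<psi>\<^sub>t x t = D * \<psi>\<^sub>x\<^sub>x x t + f\<^sub>0 * \<psi> x t)) \<and>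
     (\<forall>t>0. \<psi> (A t) t = 0 \<and> \<psi> (A t + L t) t = 0)"

end

theory Submission
  imports Defs "HOL-Real_Asymp.Real_Asymp"
begin

text \<open>
  Write \<open>\<tau> = t + 1\<close> and divide \<open>\<psi>\<close> by the solution \<open>exp (f\<^sub>0 t - x\<^sup>2 / (4 D \<tau>)) / sqrt \<tau>\<close> of the equation on
  the whole line. In the variables \<open>z = x / \<tau>\<close>, \<open>s = - 1 / \<tau>\<close> the quotient \<open>W\<close> solves \<open>W\<^sub>s = D W\<^sub>z\<^sub>z\<close> for
  \<open>s\<close> up to \<open>0\<close>, on an interval \<open>(-l, l)\<close> that tends to \<open>(-c, c)\<close> and whose ends move outwards with speed
  \<open>\<alpha> ln \<tau> + O(1)\<close>. This speed is unbounded but so mild that explicit barriers, compared with \<open>W\<close> by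
  the maximum principle, show that \<open>W\<close> stays comparable to the distance \<open>y / \<tau>\<close> from the
  boundary. Near \<open>x = A t\<close> the Gaussian factor is of the exact order \<open>\<tau> powr (\<alpha> c / (2 D) - 1 / 2)\<close>.
\<close>

text \<open>The obstacle is the drift seen from the moving end: with y = (x - A t) / \<tau> it
  equals \<Lambda> = A - \<tau> A' = \<alpha> ln \<tau> + O(1), which is unbounded as s tends to 0.
  It carries W away from y = 0, so the upper bound needs only that \<Lambda> is bounded below. The
  lower bound has to pay for it. What saves it is that only a finite amount of s-time remains and
  that ln \<tau> = - ln (-s) grows slowly: a barrier may decay at the rate sqrt \<tau> = (-s) powr
  (- 1 / 2), which beats every power of \<Lambda> and is still integrable up to s = 0, so that only
  a bounded factor is lost.

  Nothing is known at time 0, and \<psi> may initially be positive at a single known point. Both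
  bounds therefore spend one unit of time on regularisation, from bounded to linear near the end for
  the upper one, and from positive to linear (a Hopf-type estimate) for the lower one. Every barrier
  satisfies a strict differential inequality, so an elementary minimum principle suffices.\<close>

section \<open>Maximum principle between moving boundaries\<close>

lemma compact_moving_window:
  fixes p q :: "real \<Rightarrow> real"
  assumes p: "continuous_on {T0..T1} p" and q: "continuous_on {T0..T1} q"
  shows "compact {(x, t). T0 \<le> t \<and> t \<le> T1 \<and> p t \<le> x \<and> x \<le> q t}"
proof -
  define R where "R = {(x, t). T0 \<le> t \<and> t \<le> T1 \<and> p t \<le> x \<and> x \<le> q t}"
  have "bounded (p ` {T0..T1})" "bounded (q ` {T0..T1})"
    by (auto intro!: compact_imp_bounded compact_continuous_image p q)
  then obtain a a' where a: "\<And>t. t \<in> {T0..T1} \<Longrightarrow> \<bar>p t\<bar> \<le> a" "\<And>t. t \<in> {T0..T1} \<Longrightarrow> \<bar>q t\<bar> \<le> a'"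
    unfolding bounded_iff by (metis imageI real_norm_def)
  have "R \<subseteq> {-a..a'} \<times> {T0..T1}"
    unfolding R_def using a by fastforce
  then have bd: "bounded R"
    by (metis bounded_Times bounded_closed_interval bounded_subset)
  have c1: "continuous_on (UNIV \<times> {T0..T1}) (\<lambda>z. p (snd z))" "continuous_on (UNIV \<times> {T0..T1}) (\<lambda>z. q (snd z))"
    by (auto intro!: continuous_on_compose2[OF p] continuous_on_compose2[OF q] continuous_intros)
  have cl0: "closed (UNIV \<times> {T0..T1} :: (real\<times>real) set)" by (intro closed_Times) auto
  have "R = {z \<in> UNIV \<times> {T0..T1}. p (snd z) \<le> fst z} \<inter> {z \<in> UNIV \<times> {T0..T1}. fst z \<le> q (snd z)}"
    by (auto simp: R_def)
  moreover have "closed {z \<in> UNIV \<times> {T0..T1}. p (snd z) \<le> fst z}"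
    by (intro continuous_on_closed_Collect_le c1 cl0 continuous_intros)
  moreover have "closed {z \<in> UNIV \<times> {T0..T1}. fst z \<le> q (snd z)}"
    by (intro continuous_on_closed_Collect_le c1 cl0 continuous_intros)
  ultimately have "closed R" by auto
  then show ?thesis using bd compact_eq_bounded_closed unfolding R_def by blast
qed

text \<open>At a negative interior minimum \<open>wx = 0\<close>, \<open>wxx \<ge> 0\<close> and
  \<open>wt \<le> 0\<close>, which contradicts the strict inequality directly. Since
  \<open>wx\<close> vanishes there, no bound on the drift \<open>b\<close> is required.\<close>

lemma parabolic_minimum_principle:
  fixes w wt wx wxx b :: "real \<Rightarrow> real \<Rightarrow> real" and p q :: "real \<Rightarrow> real"
  assumes D: "D \<ge> 0" and p: "continuous_on {T0..T1} p" and q: "continuous_on {T0..T1} q"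
    and cont: "continuous_on {(x, t). T0 \<le> t \<and> t \<le> T1 \<and> p t \<le> x \<and> x \<le> q t} (\<lambda>(x, t). w x t)"
    and dt: "\<And>x t. \<lbrakk>T0 < t; t \<le> T1; p t < x; x < q t\<rbrakk> \<Longrightarrow> ((\<lambda>s. w x s) has_real_derivative wt x t) (at t)"
    and dx: "\<And>x t. \<lbrakk>T0 < t; t \<le> T1; p t < x; x < q t\<rbrakk> \<Longrightarrow> ((\<lambda>z. w z t) has_real_derivative wx x t) (at x)"
    and dxx: "\<And>x t. \<lbrakk>T0 < t; t \<le> T1; p t < x; x < q t\<rbrakk> \<Longrightarrow> ((\<lambda>z. wx z t) has_real_derivative wxx x t) (at x)"
    and strict: "\<And>x t. \<lbrakk>T0 < t; t \<le> T1; p t < x; x < q t\<rbrakk> \<Longrightarrow> D * wxx x t + b x t * wx x t < wt x t"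
    and init: "\<And>x. \<lbrakk>p T0 \<le> x; x \<le> q T0\<rbrakk> \<Longrightarrow> 0 \<le> w x T0"
    and lateral: "\<And>t. \<lbrakk>T0 \<le> t; t \<le> T1; p t \<le> q t\<rbrakk> \<Longrightarrow> 0 \<le> w (p t) t"
      "\<And>t. \<lbrakk>T0 \<le> t; t \<le> T1; p t \<le> q t\<rbrakk> \<Longrightarrow> 0 \<le> w (q t) t"
    and xt: "T0 \<le> t" "t \<le> T1" "p t \<le> x" "x \<le> q t"
  shows "0 \<le> w x t"
proof -
  define R where "R = {(x, t). T0 \<le> t \<and> t \<le> T1 \<and> p t \<le> x \<and> x \<le> q t}"
  have ne: "(x, t) \<in> R" using xt by (auto simp: R_def)
  have "compact R" unfolding R_def by (rule compact_moving_window[OF p q])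
  then obtain x0 t0 where m: "(x0, t0) \<in> R" "\<And>x t. (x, t) \<in> R \<Longrightarrow> w x0 t0 \<le> w x t"
    using continuous_attains_inf[of R "\<lambda>(x, t). w x t"] ne cont[folded R_def] by fastforce
  have "0 \<le> w x0 t0"
  proof (rule ccontr)
    assume neg: "\<not> 0 \<le> w x0 t0"
    have h: "T0 < t0" "t0 \<le> T1" "p t0 < x0" "x0 < q t0"
    proof -
      have r: "T0 \<le> t0" "t0 \<le> T1" "p t0 \<le> x0" "x0 \<le> q t0" using m(1) by (auto simp: R_def)
      have "t0 \<noteq> T0" using init[of x0] r neg by metis
      moreover have "x0 \<noteq> p t0" "x0 \<noteq> q t0" using lateral[of t0] r neg by (metis order_trans)+
      ultimately show "T0 < t0" "t0 \<le> T1" "p t0 < x0" "x0 < q t0" using r by linarith+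
    qed
    define d where "d = min (x0 - p t0) (q t0 - x0)"
    have d: "d > 0" using h by (auto simp: d_def)
    have inR: "(z, t0) \<in> R" if "\<bar>x0 - z\<bar> < d" for z
      using that h unfolding R_def d_def by auto
    have wx0: "wx x0 t0 = 0"
      using DERIV_local_min[OF dx[OF h] d] m(2) inR by blast
    have wxx0: "wxx x0 t0 \<ge> 0"
    proof (rule ccontr)
      assume "\<not> wxx x0 t0 \<ge> 0"
      then obtain e where e: "e > 0" "\<And>k. 0 < k \<Longrightarrow> k < e \<Longrightarrow> wx (x0 + k) t0 < wx x0 t0"
        using DERIV_neg_dec_right[OF dxx[OF h]] by auto
      define k where "k = min e d / 2"
      have k: "0 < k" "k < e" "k < d" using e d by (auto simp: k_def)
      have "\<exists>z. x0 < z \<and> z < x0 + k \<and> w (x0 + k) t0 - w x0 t0 = (x0 + k - x0) * wx z t0"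
        using h k d_def by (intro MVT2) (auto intro!: dx)
      then obtain z where z: "x0 < z" "z < x0 + k" "w (x0 + k) t0 - w x0 t0 = k * wx z t0" by auto
      have "wx z t0 < 0" using e(2)[of "z - x0"] z k wx0 by auto
      then have "w (x0 + k) t0 < w x0 t0" using z(3) k(1) mult_pos_neg[of k "wx z t0"] by linarith
      then show False using m(2)[OF inR[of "x0 + k"]] k by auto
    qed
    have "wt x0 t0 \<le> 0"
    proof (rule ccontr)
      assume "\<not> wt x0 t0 \<le> 0"
      then obtain e where e: "e > 0" "\<And>k. 0 < k \<Longrightarrow> k < e \<Longrightarrow> w x0 (t0 - k) < w x0 t0"
        using DERIV_pos_inc_left[OF dt[OF h]] by auto
      \<comment> \<open>The minimum may sit at the final time, so it is compared with earlier times
        only; continuity of the moving ends keeps \<open>x0\<close> inside the window for a short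
        while backwards.\<close>
      have "\<forall>\<^sub>F s in at t0 within {T0..T1}. p s < x0" "\<forall>\<^sub>F s in at t0 within {T0..T1}. x0 < q s"
        using p q h by (auto simp: continuous_on_def intro!: order_tendstoD)
      then have "\<forall>\<^sub>F s in at t0 within {T0..T1}. p s < x0 \<and> x0 < q s"
        by (rule eventually_conj)
      then obtain r where r: "r > 0" "\<And>s. s \<in> {T0..T1} \<Longrightarrow> s \<noteq> t0 \<Longrightarrow> dist s t0 < r \<Longrightarrow> p s < x0 \<and> x0 < q s"
        unfolding eventually_at by blast
      define k where "k = min (min e r) (t0 - T0) / 2"
      have k: "0 < k" "k < e" "k < r" "k < t0 - T0" using e r h by (auto simp: k_def)
      have "(x0, t0 - k) \<in> R" using r(2)[of "t0 - k"] k h by (auto simp: R_def dist_real_def)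
      then show False using m(2) e(2)[of k] k by force
    qed
    moreover have "0 \<le> D * wxx x0 t0" using D wxx0 by simp
    ultimately show False using strict[OF h] wx0 by simp
  qed
  then show ?thesis using m(2)[OF ne] by linarith
qed

section \<open>The equation for the quotient and the upper barrier\<close>

text \<open>The strip is symmetric because A = - L / 2. In \<open>W_eq\<close> the drift x / (t + 1)
  is transport along the lines x / (t + 1) = const; it disappears in the variable z, where the
  equation is the plain heat equation.\<close>

locale strip_solution =
  fixes D :: real and A A' :: "real \<Rightarrow> real" and W Wt Wx Wxx :: "real \<Rightarrow> real \<Rightarrow> real"
  assumes D_pos: "D > 0"
    and A_neg: "\<And>t. t \<ge> 0 \<Longrightarrow> A t < 0"
    and A_deriv: "\<And>t. t > 0 \<Longrightarrow> (A has_real_derivative A' t) (at t)"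
    and A'_cont: "continuous_on {0<..} A'"
    and W_cont: "continuous_on {(x, t). 0 < t \<and> A t \<le> x \<and> x \<le> - A t} (\<lambda>(x, t). W x t)"
    and W_dt: "\<And>x t. \<lbrakk>0 < t; A t < x; x < - A t\<rbrakk> \<Longrightarrow> ((\<lambda>s. W x s) has_real_derivative Wt x t) (at t)"
    and W_dx: "\<And>x t. \<lbrakk>0 < t; A t < x; x < - A t\<rbrakk> \<Longrightarrow> ((\<lambda>z. W z t) has_real_derivative Wx x t) (at x)"
    and W_dxx: "\<And>x t. \<lbrakk>0 < t; A t < x; x < - A t\<rbrakk> \<Longrightarrow> ((\<lambda>z. Wx z t) has_real_derivative Wxx x t) (at x)"
    and W_eq: "\<And>x t. \<lbrakk>0 < t; A t < x; x < - A t\<rbrakk> \<Longrightarrow> Wt x t = D * Wxx x t - x / (t + 1) * Wx x t"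
    and W_nonneg: "\<And>x t. \<lbrakk>0 < t; A t \<le> x; x \<le> - A t\<rbrakk> \<Longrightarrow> 0 \<le> W x t"
    and W_bdry: "\<And>t. 0 < t \<Longrightarrow> W (A t) t = 0" "\<And>t. 0 < t \<Longrightarrow> W (- A t) t = 0"
begin

lemma A_cont: "continuous_on {0<..} A"
  using A_deriv by (meson DERIV_continuous_on greaterThan_iff has_field_derivative_at_within)

lemma A_cont_Icc: "0 < T0 \<Longrightarrow> continuous_on {T0..T1} A"
  by (rule continuous_on_subset[OF A_cont]) auto

text \<open>With \<open>\<sigma> = 1\<close> the barrier is a subsolution, with \<open>\<sigma> = - 1\<close> a supersolution.\<close>

lemma comparison:
  fixes B Bt Bx Bxx :: "real \<Rightarrow> real \<Rightarrow> real" and p q :: "real \<Rightarrow> real" and \<sigma> :: real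
  assumes T0: "0 < T0" and p: "continuous_on {T0..T1} p" and q: "continuous_on {T0..T1} q"
    and window: "\<And>t. \<lbrakk>T0 \<le> t; t \<le> T1\<rbrakk> \<Longrightarrow> A t \<le> p t \<and> q t \<le> - A t"
    and cont: "continuous_on {(x, t). T0 \<le> t \<and> t \<le> T1 \<and> p t \<le> x \<and> x \<le> q t} (\<lambda>(x, t). B x t)"
    and dt: "\<And>x t. \<lbrakk>T0 < t; t \<le> T1; p t < x; x < q t\<rbrakk> \<Longrightarrow> ((\<lambda>s. B x s) has_real_derivative Bt x t) (at t)"
    and dx: "\<And>x t. \<lbrakk>T0 < t; t \<le> T1; p t < x; x < q t\<rbrakk> \<Longrightarrow> ((\<lambda>z. B z t) has_real_derivative Bx x t) (at x)"
    and dxx: "\<And>x t. \<lbrakk>T0 < t; t \<le> T1; p t < x; x < q t\<rbrakk> \<Longrightarrow> ((\<lambda>z. Bx z t) has_real_derivative Bxx x t) (at x)"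
    and strict: "\<And>x t. \<lbrakk>T0 < t; t \<le> T1; p t < x; x < q t\<rbrakk> \<Longrightarrow> 
      \<sigma> * (Bt x t - D * Bxx x t + x / (t + 1) * Bx x t) < 0"
    and init: "\<And>x. \<lbrakk>p T0 \<le> x; x \<le> q T0\<rbrakk> \<Longrightarrow> \<sigma> * B x T0 \<le> \<sigma> * W x T0"
    and lateral: "\<And>t. \<lbrakk>T0 \<le> t; t \<le> T1; p t \<le> q t\<rbrakk> \<Longrightarrow> \<sigma> * B (p t) t \<le> \<sigma> * W (p t) t"
      "\<And>t. \<lbrakk>T0 \<le> t; t \<le> T1; p t \<le> q t\<rbrakk> \<Longrightarrow> \<sigma> * B (q t) t \<le> \<sigma> * W (q t) t"
    and xt: "T0 \<le> t" "t \<le> T1" "p t \<le> x" "x \<le> q t"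
  shows "\<sigma> * B x t \<le> \<sigma> * W x t"
proof -
  have "0 \<le> \<sigma> * (W x t - B x t)"
  proof (rule parabolic_minimum_principle[where D = D and b = "\<lambda>x t. - x / (t + 1)"
        and wt = "\<lambda>x t. \<sigma> * (Wt x t - Bt x t)" and wx = "\<lambda>x t. \<sigma> * (Wx x t - Bx x t)"
        and wxx = "\<lambda>x t. \<sigma> * (Wxx x t - Bxx x t)" and w = "\<lambda>x t. \<sigma> * (W x t - B x t)", OF _ p q _ _ _ _ _ _ _ _ xt])
    have "continuous_on {(x, t). T0 \<le> t \<and> t \<le> T1 \<and> p t \<le> x \<and> x \<le> q t} (\<lambda>(x, t). W x t)"
      by (rule continuous_on_subset[OF W_cont]) (use T0 window in force)
    from continuous_on_mult[OF continuous_on_const continuous_on_diff[OF this cont]]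
    show "continuous_on {(x, t). T0 \<le> t \<and> t \<le> T1 \<and> p t \<le> x \<and> x \<le> q t} (\<lambda>(x, t). \<sigma> * (W x t - B x t))"
      by (simp add: case_prod_unfold)
  next
    fix x t assume h: "T0 < t" "t \<le> T1" "p t < x" "x < q t"
    have h': "0 < t" "A t < x" "x < - A t" using h T0 window[of t] by auto
    note [derivative_intros] = W_dt[OF h'] W_dx[OF h'] W_dxx[OF h'] dt[OF h] dx[OF h] dxx[OF h]
    show "((\<lambda>s. \<sigma> * (W x s - B x s)) has_real_derivative \<sigma> * (Wt x t - Bt x t)) (at t)"
      "((\<lambda>z. \<sigma> * (W z t - B z t)) has_real_derivative \<sigma> * (Wx x t - Bx x t)) (at x)"
      "((\<lambda>z. \<sigma> * (Wx z t - Bx z t)) has_real_derivative \<sigma> * (Wxx x t - Bxx x t)) (at x)"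
      by (auto intro!: derivative_eq_intros)
    show "D * (\<sigma> * (Wxx x t - Bxx x t)) + - x / (t + 1) * (\<sigma> * (Wx x t - Bx x t)) < \<sigma> * (Wt x t - Bt x t)"
      using strict[OF h] by (simp add: W_eq[OF h'] algebra_simps)
  qed (use D_pos init lateral xt in \<open>auto simp: algebra_simps\<close>)
  then show ?thesis by (simp add: algebra_simps)
qed

text \<open>In the variables \<open>y = (x - A t) / (t + 1)\<close> and \<open>s = - 1 / (t + 1)\<close> the equation is
  \<open>W\<^sub>s = D W\<^sub>y\<^sub>y - \<Lambda> W\<^sub>y\<close> with \<open>\<Lambda> = A - (t + 1) A'\<close>, so a concave exponential profile with
  \<open>D k > C\<close> is a supersolution as soon as \<open>\<Lambda> \<ge> - C\<close>.\<close>

lemma exponential_barrier: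
  assumes T0: "0 < T0" and \<Lambda>: "\<And>t. T0 \<le> t \<Longrightarrow> t \<le> T1 \<Longrightarrow> - C \<le> A t - (t + 1) * A' t"
    and k: "0 < k" "C + 1 \<le> D * k" and N: "0 < N" and M: "0 \<le> M"
    and NM: "\<And>x t. \<lbrakk>T0 \<le> t; t \<le> T1; A t < x; x < - A t\<rbrakk> \<Longrightarrow> 
      M < N * k * exp (- k * ((x - A t) / (t + 1))) / (t + 1)\<^sup>2"
    and init: "\<And>x. A T0 \<le> x \<Longrightarrow> x \<le> - A T0 \<Longrightarrow> 
      W x T0 \<le> N * (1 - exp (- k * ((x - A T0) / (T0 + 1)))) + M * (T1 - T0)"
    and xt: "T0 \<le> t" "t \<le> T1" "A t \<le> x" "x \<le> - A t"
  shows "W x t \<le> N * (1 - exp (- k * ((x - A t) / (t + 1)))) + M * (T1 - t)"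
proof -
  define B where "B x t = N * (1 - exp (- k * ((x - A t) / (t + 1)))) + M * (T1 - t)" for x t
  define E where "E x t = N * k * exp (- k * ((x - A t) / (t + 1)))" for x t
  have B_nonneg: "0 \<le> B x t" if "0 < t" "t \<le> T1" "A t \<le> x" for x t
    using that N M k unfolding B_def by (intro add_nonneg_nonneg mult_nonneg_nonneg) auto
  have "(-1) * B x t \<le> (-1) * W x t"
  proof (rule comparison[where B = B and p = A and q = "\<lambda>t. - A t" and ?T0.0 = T0 and ?T1.0 = T1
      and Bt = "\<lambda>x t. E x t * (- A' t / (t + 1) - (x - A t) / (t + 1)\<^sup>2) - M"
      and Bx = "\<lambda>x t. E x t / (t + 1)" and Bxx = "\<lambda>x t. - k * E x t / (t + 1)\<^sup>2"])
    show "continuous_on {T0..T1} A" "continuous_on {T0..T1} (\<lambda>t. - A t)"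
      using A_cont_Icc[OF T0] by (auto intro: continuous_intros)
    show "continuous_on {(x, t). T0 \<le> t \<and> t \<le> T1 \<and> A t \<le> x \<and> x \<le> - A t} (\<lambda>(x, t). B x t)"
      unfolding B_def case_prod_unfold using T0
      by (auto intro!: continuous_intros continuous_on_compose2[OF A_cont])
  next
    fix x t assume h: "T0 < t" "t \<le> T1" "A t < x" "x < - A t"
    note [derivative_intros] = A_deriv[of t]
    show "((\<lambda>s. B x s) has_real_derivative E x t * (- A' t / (t + 1) - (x - A t) / (t + 1)\<^sup>2) - M) (at t)"
      unfolding B_def E_def using h T0
      by (auto intro!: derivative_eq_intros simp: divide_simps power2_eq_square) (auto simp: algebra_simps)
    show "((\<lambda>z. B z t) has_real_derivative E x t / (t + 1)) (at x)"
      unfolding B_def E_def using h T0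
      by (auto intro!: derivative_eq_intros simp: divide_simps)
    show "((\<lambda>z. E z t / (t + 1)) has_real_derivative - k * E x t / (t + 1)\<^sup>2) (at x)"
      unfolding E_def using h T0
      by (auto intro!: derivative_eq_intros simp: divide_simps power2_eq_square)
    \<comment> \<open>The summand \<open>M * (T1 - t)\<close> costs \<open>M\<close> in the time
      derivative. The margin \<Lambda> + D k \<ge> 1 of the concave profile pays for it, by
      \<open>NM\<close>.\<close>
    have "M < E x t / (t + 1)\<^sup>2" using NM[of t x] h unfolding E_def by simp
    also have "\<dots> \<le> E x t / (t + 1)\<^sup>2 * (A t - (t + 1) * A' t + D * k)"
    proof -
      have "0 < E x t / (t + 1)\<^sup>2" using N k h T0 unfolding E_def by simp
      moreover have "1 \<le> A t - (t + 1) * A' t + D * k" using \<Lambda>[of t] h k by auto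
      ultimately show ?thesis by (metis mult.right_neutral mult_left_mono order_less_imp_le)
    qed
    also have "\<dots> = E x t * (- A' t / (t + 1) - (x - A t) / (t + 1)\<^sup>2) - D * (- k * E x t / (t + 1)\<^sup>2)
          + x / (t + 1) * (E x t / (t + 1))"
      using h T0 by (simp add: divide_simps power2_eq_square) (simp add: algebra_simps)
    finally show "- 1 * (E x t * (- A' t / (t + 1) - (x - A t) / (t + 1)\<^sup>2) - M - D * (- k * E x t / (t + 1)\<^sup>2)
          + x / (t + 1) * (E x t / (t + 1))) < 0" by simp
  next
    fix x assume "A T0 \<le> x" "x \<le> - A T0"
    then show "- 1 * B x T0 \<le> - 1 * W x T0" using init[of x] unfolding B_def by simp
  next
    fix t assume "T0 \<le> t" "t \<le> T1" "A t \<le> - A t"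
    then show "- 1 * B (A t) t \<le> - 1 * W (A t) t" "- 1 * B (- A t) t \<le> - 1 * W (- A t) t"
      using W_bdry[of t] B_nonneg[of t] T0 by auto
  qed (use T0 xt in auto)
  then show ?thesis by (simp add: B_def)
qed

text \<open>The barrier is used twice. Over one unit of time \<open>M * (T1 - t)\<close> dominates
  the merely bounded data at the start and has vanished at the end, leaving a bound that is linear
  at the boundary. From then on the same profile with \<open>M = 0\<close> is preserved for
  ever.\<close>

lemma W_linear_upper_bound:
  assumes T0: "0 < T0" and \<Lambda>: "\<And>t. T0 \<le> t \<Longrightarrow> - C \<le> A t - (t + 1) * A' t"
  shows "\<exists>N>0. \<forall>t\<ge>T0 + 1. \<forall>x. A t \<le> x \<and> x \<le> - A t \<longrightarrow> W x t \<le> N * ((x - A t) / (t + 1))"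
proof -
  define T1 where "T1 = T0 + 1"
  define K where "K = {(x, t). T0 \<le> t \<and> t \<le> T1 \<and> A t \<le> x \<and> x \<le> - A t}"
  have cK: "compact K" unfolding K_def
    by (intro compact_moving_window continuous_on_minus A_cont_Icc T0)
  have "continuous_on K (\<lambda>(x, t). W x t)"
    by (rule continuous_on_subset[OF W_cont]) (use T0 in \<open>auto simp: K_def\<close>)
  then have "bounded ((\<lambda>(x, t). W x t) ` K)" using cK compact_continuous_image compact_imp_bounded by blast
  then obtain M where M: "M > 0" "\<And>x t. (x, t) \<in> K \<Longrightarrow> W x t \<le> M"
    unfolding bounded_pos by force
  have "bounded (A ` {T0..T1})"
    by (intro compact_imp_bounded compact_continuous_image A_cont_Icc T0) auto
  then obtain a where a: "a > 0" "\<And>t. T0 \<le> t \<Longrightarrow> t \<le> T1 \<Longrightarrow> \<bar>A t\<bar> \<le> a"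
    unfolding bounded_pos by force
  define k where "k = (\<bar>C\<bar> + 1) / D"
  have k: "k > 0" "C + 1 \<le> D * k" using D_pos by (auto simp: k_def)
  \<comment> \<open>Since (x - A t) / (t + 1) \<le> 2 a and t \<le> T1 on the window, these factors
    make the right-hand side of the strictness condition at least \<open>M + 1\<close>.\<close>
  define N where "N = (M + 1) * exp (k * (2 * a)) * (T1 + 1)\<^sup>2 / k"
  have N: "N > 0" using M k T0 by (auto simp: N_def T1_def)
  have first: "W x T1 \<le> N * (1 - exp (- k * ((x - A T1) / (T1 + 1)))) + M * (T1 - T1)"
    if "A T1 \<le> x" "x \<le> - A T1" for x
  proof (rule exponential_barrier[OF T0 _ k N, where M = M])
    fix x t assume h: "T0 \<le> t" "t \<le> T1" "A t < x" "x < - A t"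
    have "(x - A t) / (t + 1) \<le> (x - A t) / 1"
      using h T0 by (intro divide_left_mono) auto
    also have "\<dots> \<le> 2 * a" using a(2)[OF h(1,2)] h by auto
    finally have "k * ((x - A t) / (t + 1)) \<le> k * (2 * a)" using k by (intro mult_left_mono) auto
    then have "exp (- (k * (2 * a))) \<le> exp (- k * ((x - A t) / (t + 1)))" by simp
    moreover have "(t + 1)\<^sup>2 \<le> (T1 + 1)\<^sup>2" using h T0 by (intro power_mono) auto
    ultimately have "N * k * exp (- (k * (2 * a))) / (T1 + 1)\<^sup>2 \<le> N * k * exp (- k * ((x - A t) / (t + 1))) / (t + 1)\<^sup>2"
      using N k h T0 by (intro frac_le mult_left_mono) auto
    moreover have "N * k * exp (- (k * (2 * a))) / (T1 + 1)\<^sup>2 = M + 1"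
    proof -
      have "T1 + 1 \<noteq> 0" using T0 by (simp add: T1_def)
      then show ?thesis using k by (simp add: N_def exp_minus field_simps)
    qed
    ultimately show "M < N * k * exp (- k * ((x - A t) / (t + 1))) / (t + 1)\<^sup>2" by linarith
  next
    fix x assume "A T0 \<le> x" "x \<le> - A T0"
    then have "W x T0 \<le> M" "0 \<le> N * (1 - exp (- k * ((x - A T0) / (T0 + 1))))"
      using M(2)[of x T0] N k T0 by (auto simp: K_def T1_def)
    then show "W x T0 \<le> N * (1 - exp (- k * ((x - A T0) / (T0 + 1)))) + M * (T1 - T0)"
      by (simp add: T1_def)
  qed (use M that \<Lambda> T1_def in auto)
  have "W x t \<le> N * k * ((x - A t) / (t + 1))" if h: "T1 \<le> t" "A t \<le> x" "x \<le> - A t" for x t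
  proof -
    have "W x t \<le> N * (1 - exp (- k * ((x - A t) / (t + 1)))) + 0 * (t - t)"
    proof (rule exponential_barrier[where ?T0.0 = T1, OF _ _ k N])
      show "0 < N * k * exp (- k * ((x - A t) / (t + 1))) / (t + 1)\<^sup>2" if "T1 \<le> t" for x t
        using that N k T0 by (auto simp: T1_def)
    qed (use first \<Lambda> T0 h T1_def in auto)
    also have "\<dots> \<le> N * (k * ((x - A t) / (t + 1)))"
    proof -
      have "1 - exp (- k * ((x - A t) / (t + 1))) \<le> k * ((x - A t) / (t + 1))"
        using exp_ge_add_one_self[of "- k * ((x - A t) / (t + 1))"] by linarith
      from mult_left_mono[OF this less_imp_le[OF N]] show ?thesis by linarith
    qed
    finally show ?thesis by (simp add: mult.assoc)
  qed
  then show ?thesis using N k by (intro exI[of _ "N * k"]) (auto simp: T1_def)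
qed

section \<open>Strict positivity and linear growth at the boundary\<close>

text \<open>A strong maximum principle made explicit: a small bump, decaying exponentially in time,
  is carried as a subsolution along a curve that joins the two points inside the strip.\<close>

lemma positivity_propagates:
  assumes t: "0 < t0" "t0 < t1" and x0: "A t0 < x0" "x0 < - A t0" and pos: "0 < W x0 t0"
    and x1: "A t1 < x1" "x1 < - A t1"
  shows "0 < W x1 t1"
proof -
  define v0 v1 where "v0 = x0 / (- A t0)" and "v1 = x1 / (- A t1)"
  define Q where "Q = max \<bar>v0\<bar> \<bar>v1\<bar>"
  have An: "A s < 0" if "t0 \<le> s" for s using A_neg t that by simp
  have v: "v0 * (- A t0) = x0" "v1 * (- A t1) = x1"
    using An[of t0] An[of t1] t by (auto simp: v0_def v1_def)
  have Q: "Q < 1"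
    using An[of t0] An[of t1] t x0 x1 by (auto simp: Q_def v0_def v1_def abs_less_iff field_simps)
  \<comment> \<open>Interpolating the ratio x / (- A) instead of x keeps the curve in the moving
    strip: the ratio stays within [-Q, Q] with Q < 1, which also bounds its distance to both ends
    from below.\<close>
  define v where "v s = v0 + (v1 - v0) * ((s - t0) / (t1 - t0))" for s
  define m where "m s = - A s * v s" for s
  define m' where "m' s = - A' s * v s - A s * ((v1 - v0) / (t1 - t0))" for s
  have vQ: "\<bar>v s\<bar> \<le> Q" if "t0 \<le> s" "s \<le> t1" for s
  proof -
    define l where "l = (s - t0) / (t1 - t0)"
    have l: "0 \<le> l" "l \<le> 1" using that t by (auto simp: l_def)
    have "\<bar>v s\<bar> = \<bar>(1 - l) * v0 + l * v1\<bar>" by (simp add: v_def l_def[symmetric] algebra_simps)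
    also have "\<dots> \<le> (1 - l) * \<bar>v0\<bar> + l * \<bar>v1\<bar>"
      using l abs_triangle_ineq[of "(1 - l) * v0" "l * v1"] by (simp add: abs_mult)
    also have "\<dots> \<le> (1 - l) * Q + l * Q"
      using l by (intro add_mono mult_left_mono) (auto simp: Q_def)
    finally show ?thesis by (simp add: algebra_simps)
  qed
  have m_deriv: "(m has_real_derivative m' s) (at s)" if "t0 \<le> s" for s
    unfolding m_def[abs_def] m'_def v_def using that t
    by (auto intro!: derivative_eq_intros A_deriv simp: divide_simps) 
  have m_cont: "continuous_on {t0..t1} m"
    using m_deriv by (meson DERIV_continuous_on atLeastAtMost_iff has_field_derivative_at_within)
  have A_c: "continuous_on {t0..t1} A" using A_cont_Icc t by blast
  have m'_cont: "continuous_on {t0..t1} m'"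
    unfolding m'_def v_def using t
    by (auto intro!: continuous_intros A_c continuous_on_subset[OF A'_cont])
  have "bounded (A ` {t0..t1})" "bounded (m' ` {t0..t1})"
    by (auto intro!: compact_imp_bounded compact_continuous_image A_c m'_cont)
  then obtain a P where a: "a > 0" "\<And>s. s \<in> {t0..t1} \<Longrightarrow> \<bar>A s\<bar> \<le> a" 
    and P: "P > 0" "\<And>s. s \<in> {t0..t1} \<Longrightarrow> \<bar>m' s\<bar> \<le> P"
    unfolding bounded_pos by (auto simp: ball_simps)
  obtain z where z: "z \<in> {t0..t1}" "\<And>s. s \<in> {t0..t1} \<Longrightarrow> A s \<le> A z"
    using continuous_attains_sup[OF compact_Icc _ A_c] t by fastforce
  define a0 where "a0 = - A z"
  have a0: "a0 > 0" "\<And>s. s \<in> {t0..t1} \<Longrightarrow> a0 \<le> - A s" using z An[of z] by (auto simp: a0_def)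
  define \<epsilon> where "\<epsilon> = W x0 t0 / 2"
  have \<epsilon>: "\<epsilon> > 0" using pos by (simp add: \<epsilon>_def)
  have "isCont (\<lambda>z. W z t0) x0" using W_dx[of t0 x0] x0 t DERIV_isCont by blast
  then have "\<forall>\<^sub>F z in at x0. \<epsilon> < W z t0" unfolding isCont_def
    by (rule order_tendstoD) (use pos in \<open>simp add: \<epsilon>_def\<close>)
  then obtain r0 where r0: "r0 > 0" "\<And>z. z \<noteq> x0 \<Longrightarrow> \<bar>z - x0\<bar> < r0 \<Longrightarrow> \<epsilon> < W z t0"
    unfolding eventually_at by (auto simp: dist_real_def)
  have r0': "\<epsilon> \<le> W z t0" if "\<bar>z - x0\<bar> < r0" for z
    using r0(2)[OF _ that] pos by (cases "z = x0") (auto simp: \<epsilon>_def less_imp_le)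
  define r where "r = min (r0 / 2) ((1 - Q) * a0)"
  have r: "r > 0" "r < r0" "r \<le> (1 - Q) * a0" using r0(1) Q a0 by (auto simp: r_def)
  have window: "A s \<le> m s - r \<and> m s + r \<le> - A s" if s: "t0 \<le> s" "s \<le> t1" for s
  proof -
    have "\<bar>m s\<bar> \<le> - A s * Q"
      using vQ[OF s] An[OF s(1)] by (auto simp: m_def abs_mult intro: mult_left_mono)
    moreover have "(1 - Q) * a0 \<le> (1 - Q) * - A s" using Q a0(2)[of s] s by (intro mult_left_mono) auto
    then have "r \<le> - A s - (- A s * Q)" using r(3) by (simp add: algebra_simps)
    ultimately show ?thesis by linarith
  qed
  define P0 where "P0 = 12 * D / r\<^sup>2 + 4 * P / r + 4 * a / r"
  define \<mu> where "\<mu> = P0\<^sup>2 * r\<^sup>2 / (32 * D) + 1"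
  have \<mu>: "\<mu> > 0" "P0\<^sup>2 < 32 * \<mu> * D / r\<^sup>2"
  proof -
    show "\<mu> > 0" using D_pos unfolding \<mu>_def by (intro add_nonneg_pos) auto
    have "32 * \<mu> * D / r\<^sup>2 = P0\<^sup>2 + 32 * D / r\<^sup>2"
      using D_pos r by (simp add: \<mu>_def field_simps)
    then show "P0\<^sup>2 < 32 * \<mu> * D / r\<^sup>2" using D_pos r by simp
  qed
  define E where "E s = \<epsilon> * exp (- \<mu> * (s - t0))" for s
  have E: "E s > 0" for s using \<epsilon> by (simp add: E_def)
  define \<theta> where "\<theta> x s = (x - m s) / r" for x s
  \<comment> \<open>The outer square matters at the rim: there the decay term vanishes to second
    order in u and the drift term to first order, while the second derivative of the squared bump is
    still positive.\<close>
  define B where "B x s = E s * (1 - (\<theta> x s)\<^sup>2)\<^sup>2" for x s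
  have "1 * B x1 t1 \<le> 1 * W x1 t1"
  proof (rule comparison[where B = B and p = "\<lambda>s. m s - r" and q = "\<lambda>s. m s + r" and ?T0.0 = t0 and ?T1.0 = t1
      and Bt = "\<lambda>x s. E s * (- \<mu> * (1 - (\<theta> x s)\<^sup>2)\<^sup>2 + 4 * (1 - (\<theta> x s)\<^sup>2) * \<theta> x s * m' s / r)"
      and Bx = "\<lambda>x s. E s * (- 4 * (1 - (\<theta> x s)\<^sup>2) * \<theta> x s / r)" 
      and Bxx = "\<lambda>x s. E s * ((8 - 12 * (1 - (\<theta> x s)\<^sup>2)) / r\<^sup>2)"])
    show "A s \<le> m s - r \<and> m s + r \<le> - A s" if "t0 \<le> s" "s \<le> t1" for s
      by (rule window[OF that])
  next
    show "continuous_on {(x, s). t0 \<le> s \<and> s \<le> t1 \<and> m s - r \<le> x \<and> x \<le> m s + r} (\<lambda>(x, s). B x s)"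
      unfolding B_def E_def \<theta>_def case_prod_unfold using r
      by (auto intro!: continuous_intros continuous_on_compose2[OF m_cont])
  next
    fix x s assume h: "t0 < s" "s \<le> t1" "m s - r < x" "x < m s + r"
    have [derivative_intros]: "((\<lambda>s. \<theta> x s) has_real_derivative - m' s / r) (at s)"
      "((\<lambda>z. \<theta> z s) has_real_derivative 1 / r) (at x)"
      unfolding \<theta>_def using h r by (auto intro!: derivative_eq_intros m_deriv[of s])
    show "((\<lambda>s. B x s) has_real_derivative E s * (- \<mu> * (1 - (\<theta> x s)\<^sup>2)\<^sup>2 + 4 * (1 - (\<theta> x s)\<^sup>2) * \<theta> x s * m' s / r)) (at s)"
      unfolding B_def E_def
      by (auto intro!: derivative_eq_intros) (use r in \<open>auto simp: power2_eq_square field_simps\<close>)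
    show "((\<lambda>z. B z s) has_real_derivative E s * (- 4 * (1 - (\<theta> x s)\<^sup>2) * \<theta> x s / r)) (at x)"
      unfolding B_def
      by (auto intro!: derivative_eq_intros) (use r in \<open>auto simp: power2_eq_square field_simps\<close>)
    show "((\<lambda>z. E s * (- 4 * (1 - (\<theta> z s)\<^sup>2) * \<theta> z s / r)) has_real_derivative E s * ((8 - 12 * (1 - (\<theta> x s)\<^sup>2)) / r\<^sup>2)) (at x)"
      by (rule derivative_eq_intros refl | use r in \<open>simp add: field_simps power2_eq_square\<close>)+
    define u where "u = 1 - (\<theta> x s)\<^sup>2"
    have th: "\<bar>\<theta> x s\<bar> < 1" using h r by (auto simp: \<theta>_def abs_less_iff field_simps)
    have u: "0 < u" unfolding u_def using th by (simp add: abs_square_less_1)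
    have "\<bar>x\<bar> \<le> a" using window[of s] a(2)[of s] h by auto
    moreover have "\<bar>x / (s + 1)\<bar> \<le> \<bar>x\<bar> / 1"
      unfolding abs_divide using h t by (intro divide_left_mono) auto
    ultimately have "\<bar>x / (s + 1)\<bar> \<le> a" by linarith
    then have "\<bar>m' s - x / (s + 1)\<bar> \<le> P + a" using P(2)[of s] h abs_triangle_ineq4[of "m' s" "x / (s + 1)"] by simp
    then have "\<bar>\<theta> x s * (m' s - x / (s + 1))\<bar> \<le> 1 * (P + a)"
      unfolding abs_mult using th by (intro mult_mono) auto
    then have "4 * u / r * (\<theta> x s * (m' s - x / (s + 1))) \<le> 4 * u / r * (P + a)"
      using u r by (intro mult_left_mono) auto
    then have "- \<mu> * u\<^sup>2 + 4 * u / r * (\<theta> x s * (m' s - x / (s + 1))) - D * ((8 - 12 * u) / r\<^sup>2)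
       \<le> - (\<mu> * u\<^sup>2 - P0 * u + 8 * D / r\<^sup>2)"
    proof -
      have "P0 * u = 4 * u / r * (P + a) + 12 * D * u / r\<^sup>2" by (simp add: P0_def algebra_simps add_divide_distrib)
      moreover have "D * ((8 - 12 * u) / r\<^sup>2) = 8 * D / r\<^sup>2 - 12 * D * u / r\<^sup>2"
        by (simp add: algebra_simps diff_divide_distrib)
      moreover note \<open>4 * u / r * (\<theta> x s * (m' s - x / (s + 1))) \<le> 4 * u / r * (P + a)\<close>
      ultimately show ?thesis by linarith
    qed
    also have "\<dots> < 0"
    proof -
      have "0 < (2 * \<mu> * u - P0)\<^sup>2 + (32 * \<mu> * D / r\<^sup>2 - P0\<^sup>2)" using \<mu> by (intro add_nonneg_pos) auto
      also have "\<dots> = (4 * \<mu>) * (\<mu> * u\<^sup>2 - P0 * u + 8 * D / r\<^sup>2)" by (simp add: power2_eq_square algebra_simps)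
      finally show ?thesis using \<mu>(1) by (simp add: zero_less_mult_iff)
    qed
    finally have neg: "- \<mu> * u\<^sup>2 + 4 * u / r * (\<theta> x s * (m' s - x / (s + 1))) - D * ((8 - 12 * u) / r\<^sup>2) < 0" .
    have "1 * (E s * (- \<mu> * u\<^sup>2 + 4 * u * \<theta> x s * m' s / r) - D * (E s * ((8 - 12 * u) / r\<^sup>2))
        + x / (s + 1) * (E s * (- 4 * u * \<theta> x s / r)))
      = E s * (- \<mu> * u\<^sup>2 + 4 * u / r * (\<theta> x s * (m' s - x / (s + 1))) - D * ((8 - 12 * u) / r\<^sup>2))"
      by (simp add: algebra_simps)
    also have "\<dots> < 0" using E[of s] neg by (simp add: mult_pos_neg)
    finally show "1 * (E s * (- \<mu> * (1 - (\<theta> x s)\<^sup>2)\<^sup>2 + 4 * (1 - (\<theta> x s)\<^sup>2) * \<theta> x s * m' s / r)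
        - D * (E s * ((8 - 12 * (1 - (\<theta> x s)\<^sup>2)) / r\<^sup>2)) + x / (s + 1) * (E s * (- 4 * (1 - (\<theta> x s)\<^sup>2) * \<theta> x s / r))) < 0"
      unfolding u_def .
  next
    fix x assume h: "m t0 - r \<le> x" "x \<le> m t0 + r"
    have "m t0 = x0" using v by (simp add: m_def v_def algebra_simps)
    then have "\<epsilon> \<le> W x t0" using h r by (intro r0') auto
    moreover have "\<bar>\<theta> x t0\<bar> \<le> 1" using h r by (auto simp: \<theta>_def abs_le_iff field_simps)
    then have "(\<theta> x t0)\<^sup>2 \<le> 1" by (simp add: abs_square_le_1)
    then have "(1 - (\<theta> x t0)\<^sup>2)\<^sup>2 \<le> 1" by (auto simp: abs_square_le_1)
    then have "B x t0 \<le> \<epsilon>" using \<epsilon> by (simp add: B_def E_def)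
    ultimately show "1 * B x t0 \<le> 1 * W x t0" by simp
  next
    fix s assume s: "t0 \<le> s" "s \<le> t1"
    note window[OF s]
    moreover have "(- r / r)\<^sup>2 = 1" "(r / r)\<^sup>2 = 1" using r by auto
    ultimately show "1 * B (m s - r) s \<le> 1 * W (m s - r) s" "1 * B (m s + r) s \<le> 1 * W (m s + r) s"
      using W_nonneg[of s "m s - r"] W_nonneg[of s "m s + r"] s t r by (auto simp: B_def \<theta>_def)
  next
    have "m t1 = x1" using v t by (simp add: m_def v_def algebra_simps)
    then show "m t1 - r \<le> x1" "x1 \<le> m t1 + r" using r by auto
  qed (use t m_cont in \<open>auto intro: continuous_intros\<close>)
  moreover have "m t1 = x1" using v t by (simp add: m_def v_def algebra_simps)
  then have "B x1 t1 = E t1" by (simp add: B_def \<theta>_def)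
  ultimately show ?thesis using E[of t1] by simp
qed

lemma boundary_growth:
  assumes T0: "0 < T0" and pos: "\<And>x t. \<lbrakk>T0 \<le> t; t \<le> T0 + 1; A t < x; x < - A t\<rbrakk> \<Longrightarrow> 0 < W x t"
  shows "\<exists>\<beta>>0. \<exists>\<delta>>0. \<forall>x. A (T0 + 1) \<le> x \<and> x \<le> A (T0 + 1) + \<delta> \<longrightarrow> \<beta> * (x - A (T0 + 1)) \<le> W x (T0 + 1)"
proof -
  define T1 where "T1 = T0 + 1"
  have A_c: "continuous_on {T0..T1} A" using A_cont_Icc T0 by blast
  have "continuous_on {T0..T1} (\<lambda>s. \<bar>A' s\<bar> + \<bar>A s\<bar>)" 
    using T0 by (auto intro!: continuous_intros A_c continuous_on_subset[OF A'_cont])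
  then have "bounded ((\<lambda>s. \<bar>A' s\<bar> + \<bar>A s\<bar>) ` {T0..T1})"
    by (intro compact_imp_bounded compact_continuous_image) auto
  then obtain P where P: "P > 0" "\<And>s. s \<in> {T0..T1} \<Longrightarrow> \<bar>A' s\<bar> + \<bar>A s\<bar> \<le> P"
    unfolding bounded_pos by force
  obtain z where z: "z \<in> {T0..T1}" "\<And>s. s \<in> {T0..T1} \<Longrightarrow> A s \<le> A z"
    using continuous_attains_sup[OF compact_Icc _ A_c] by (fastforce simp: T1_def)
  define a0 where "a0 = - A z"
  have a0: "a0 > 0" "\<And>s. s \<in> {T0..T1} \<Longrightarrow> a0 \<le> - A s" using z A_neg[of z] T0 by (auto simp: a0_def)
  define \<delta> where "\<delta> = min (min 1 a0) (min (D / (2 * P)) (sqrt (D / 2)))"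
  have \<delta>: "0 < \<delta>" "\<delta> \<le> 1" "\<delta> \<le> a0" "P * \<delta> \<le> D / 2" "\<delta>\<^sup>2 \<le> D / 2"
  proof -
    show "0 < \<delta>" "\<delta> \<le> 1" "\<delta> \<le> a0" using a0 P D_pos by (auto simp: \<delta>_def)
    have "\<delta> \<le> D / (2 * P)" "\<delta> \<le> sqrt (D / 2)" by (auto simp: \<delta>_def)
    then show "P * \<delta> \<le> D / 2" using P(1) by (simp add: field_simps)
    show "\<delta>\<^sup>2 \<le> D / 2" using \<open>\<delta> \<le> sqrt (D / 2)\<close> \<open>0 < \<delta>\<close> D_pos
      by (metis less_imp_le power_mono real_sqrt_pow2 half_gt_zero)
  qed
  have inside: "A s < A s + \<delta> \<and> A s + \<delta> < - A s" if "s \<in> {T0..T1}" for s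
    using \<delta> a0(2)[OF that] a0(1) by linarith
  have "continuous_on {T0..T1} (\<lambda>s. W (A s + \<delta>) s)"
    using continuous_on_compose2[OF W_cont, of "{T0..T1}" "\<lambda>s. (A s + \<delta>, s)"] inside T0
    by (fastforce intro: continuous_intros A_c)
  from continuous_attains_inf[OF compact_Icc _ this]
  obtain s0 where s0: "s0 \<in> {T0..T1}" "\<And>s. s \<in> {T0..T1} \<Longrightarrow> W (A s0 + \<delta>) s0 \<le> W (A s + \<delta>) s"
    by (fastforce simp: T1_def)
  define \<epsilon> where "\<epsilon> = W (A s0 + \<delta>) s0"
  have \<epsilon>: "\<epsilon> > 0" using pos[of s0 "A s0 + \<delta>"] inside[OF s0(1)] s0(1) by (simp add: \<epsilon>_def T1_def)
  define \<mu> where "\<mu> = P + 3"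
  define K where "K = (\<mu> + P + 1) / D"
  have KD: "K * D = \<mu> + P + 1" using D_pos by (simp add: K_def)
  have K: "K > 0" using D_pos P by (simp add: K_def \<mu>_def)
  define \<beta> where "\<beta> = \<epsilon> / (\<delta> + K * \<delta>\<^sup>2)"
  have "\<delta> + K * \<delta>\<^sup>2 > 0" using K \<delta> by (intro add_pos_pos) auto
  then have \<beta>: "\<beta> > 0" "\<beta> * (\<delta> + K * \<delta>\<^sup>2) = \<epsilon>" using \<epsilon> by (auto simp: \<beta>_def)
  define B where "B x t = \<beta> * ((x - A t) + K * (x - A t)\<^sup>2 - \<mu> * (T1 - t))" for x t
  have B_le: "B x t \<le> \<beta> * (\<delta> + K * \<delta>\<^sup>2 - \<mu> * (T1 - t))" if "A t \<le> x" "x \<le> A t + \<delta>" for x t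
  proof -
    have "(x - A t)\<^sup>2 \<le> \<delta>\<^sup>2" using that by (intro power_mono) auto
    then have "K * (x - A t)\<^sup>2 \<le> K * \<delta>\<^sup>2" using K by simp
    then show ?thesis using \<beta> that unfolding B_def by (intro mult_left_mono) auto
  qed
  have "\<beta> * (x - A T1) \<le> W x T1" if x: "A T1 \<le> x" "x \<le> A T1 + \<delta>" for x
  proof -
    have "1 * B x T1 \<le> 1 * W x T1"
    proof (rule comparison[where B = B and p = A and q = "\<lambda>t. A t + \<delta>" and ?T0.0 = T0 and ?T1.0 = T1
        and Bt = "\<lambda>x t. \<beta> * (\<mu> - A' t * (1 + 2 * K * (x - A t)))"
        and Bx = "\<lambda>x t. \<beta> * (1 + 2 * K * (x - A t))" and Bxx = "\<lambda>x t. \<beta> * (2 * K)"])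
      show "continuous_on {(x, t). T0 \<le> t \<and> t \<le> T1 \<and> A t \<le> x \<and> x \<le> A t + \<delta>} (\<lambda>(x, t). B x t)"
        unfolding B_def case_prod_unfold by (auto intro!: continuous_intros continuous_on_compose2[OF A_c])
    next
      fix x t assume h: "T0 < t" "t \<le> T1" "A t < x" "x < A t + \<delta>"
      note [derivative_intros] = A_deriv[of t]
      show "((\<lambda>s. B x s) has_real_derivative \<beta> * (\<mu> - A' t * (1 + 2 * K * (x - A t)))) (at t)"
        "((\<lambda>z. B z t) has_real_derivative \<beta> * (1 + 2 * K * (x - A t))) (at x)"
        "((\<lambda>z. \<beta> * (1 + 2 * K * (z - A t))) has_real_derivative \<beta> * (2 * K)) (at x)"
        unfolding B_def using h T0 by (auto intro!: derivative_eq_intros simp: algebra_simps)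
      have "\<bar>x\<bar> \<le> \<bar>A t\<bar>" using h inside[of t] by auto
      moreover have "\<bar>x / (t + 1)\<bar> \<le> \<bar>x\<bar> / 1"
        unfolding abs_divide using h T0 by (intro divide_left_mono) auto
      moreover have "\<bar>A' t\<bar> + \<bar>A t\<bar> \<le> P" using P(2)[of t] h by simp
      ultimately have d: "x / (t + 1) - A' t \<le> P" by linarith
      have f: "0 \<le> 1 + 2 * K * (x - A t)" "1 + 2 * K * (x - A t) \<le> 1 + 2 * K * \<delta>" using K h by auto
      have "(x / (t + 1) - A' t) * (1 + 2 * K * (x - A t)) \<le> P * (1 + 2 * K * \<delta>)"
        using d f P(1) by (intro mult_mono) auto
      also have "\<dots> = P + 2 * K * (P * \<delta>)" by (simp add: algebra_simps)
      also have "\<dots> \<le> P + 2 * K * (D / 2)" using \<delta> K by (intro add_left_mono mult_left_mono) auto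
      finally have "\<mu> + (x / (t + 1) - A' t) * (1 + 2 * K * (x - A t)) - 2 * (K * D) < 0"
        using KD by simp
      then have "\<beta> * (\<mu> + (x / (t + 1) - A' t) * (1 + 2 * K * (x - A t)) - 2 * (K * D)) < 0"
        using \<beta>(1) by (simp add: mult_pos_neg)
      then show "1 * (\<beta> * (\<mu> - A' t * (1 + 2 * K * (x - A t))) - D * (\<beta> * (2 * K)) + x / (t + 1) * (\<beta> * (1 + 2 * K * (x - A t)))) < 0"
        by (simp add: algebra_simps)
    next
      fix x assume h: "A T0 \<le> x" "x \<le> A T0 + \<delta>"
      have "K * \<delta>\<^sup>2 \<le> K * (D / 2)" using K \<delta> by simp
      also have "\<dots> = (\<mu> + P + 1) / 2" using KD by simp
      finally have "\<delta> + K * \<delta>\<^sup>2 - \<mu> * (T1 - T0) \<le> 0" using \<delta> by (simp add: T1_def \<mu>_def)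
      then have "B x T0 \<le> 0" using B_le[OF h] \<beta>(1) by (smt (verit) mult_nonneg_nonpos)
      then show "1 * B x T0 \<le> 1 * W x T0" using W_nonneg[of T0 x] h inside[of T0] T0 by (simp add: T1_def)
    next
      fix t assume h: "T0 \<le> t" "t \<le> T1"
      have \<mu>t: "0 \<le> \<mu> * (T1 - t)" using h P by (simp add: \<mu>_def)
      then have "B (A t) t \<le> 0" using \<beta>(1) by (simp add: B_def)
      then show "1 * B (A t) t \<le> 1 * W (A t) t" using W_bdry(1)[of t] h T0 by simp
      have "B (A t + \<delta>) t \<le> \<beta> * (\<delta> + K * \<delta>\<^sup>2)" using \<mu>t \<beta>(1) by (simp add: B_def)
      then show "1 * B (A t + \<delta>) t \<le> 1 * W (A t + \<delta>) t" using \<beta>(2) s0(2)[of t] h by (simp add: \<epsilon>_def)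
    qed (use T0 A_c x inside in \<open>auto simp: T1_def intro!: continuous_intros less_imp_le\<close>)
    moreover have "\<beta> * (x - A T1) \<le> B x T1" unfolding B_def using \<beta>(1) K by (intro mult_left_mono) auto
    ultimately show ?thesis by simp
  qed
  then show ?thesis using \<beta> \<delta> unfolding T1_def by blast
qed

text \<open>Away from the left end W has a positive minimum by compactness; the smaller of the two
  slopes serves on the whole interval. This is the starting configuration for the barrier that runs
  to infinite time.\<close>

lemma linear_lower_bound_at_time:
  assumes T0: "0 < T0" and pos: "\<And>x t. \<lbrakk>T0 \<le> t; t \<le> T0 + 1; A t < x; x < - A t\<rbrakk> \<Longrightarrow> 0 < W x t"
    and q: "q < - A (T0 + 1)"
  shows "\<exists>\<beta>>0. \<forall>x. A (T0 + 1) \<le> x \<and> x \<le> q \<longrightarrow> \<beta> * (x - A (T0 + 1)) \<le> W x (T0 + 1)"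
proof -
  define T1 where "T1 = T0 + 1"
  obtain \<beta> \<delta> where b: "\<beta> > 0" "\<delta> > 0" "\<And>x. A T1 \<le> x \<Longrightarrow> x \<le> A T1 + \<delta> \<Longrightarrow> \<beta> * (x - A T1) \<le> W x T1"
    using boundary_growth[OF T0 pos] unfolding T1_def by blast
  show ?thesis
  proof (cases "A T1 + \<delta> \<le> q")
    case False
    then show ?thesis using b unfolding T1_def by (intro exI[of _ \<beta>]) auto
  next
    case True
    have "continuous_on {A T1 + \<delta>..q} (\<lambda>x. W x T1)"
      using continuous_on_compose2[OF W_cont, of "{A T1 + \<delta>..q}" "\<lambda>x. (x, T1)"] b q T0
      by (fastforce intro: continuous_intros simp: T1_def)
    from continuous_attains_inf[OF compact_Icc _ this] True
    obtain x0 where x0: "x0 \<in> {A T1 + \<delta>..q}" "\<And>x. x \<in> {A T1 + \<delta>..q} \<Longrightarrow> W x0 T1 \<le> W x T1" by fastforce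
    have e: "W x0 T1 > 0" using pos[of T1 x0] x0(1) b q by (auto simp: T1_def)
    define \<gamma> where "\<gamma> = min \<beta> (W x0 T1 / (q - A T1))"
    have \<gamma>: "\<gamma> > 0" using b e True by (auto simp: \<gamma>_def intro!: divide_pos_pos)
    have "\<gamma> * (x - A T1) \<le> W x T1" if "A T1 \<le> x" "x \<le> q" for x
    proof (cases "x \<le> A T1 + \<delta>")
      case h: True
      have "\<gamma> * (x - A T1) \<le> \<beta> * (x - A T1)" using that by (intro mult_right_mono) (auto simp: \<gamma>_def)
      then show ?thesis using b(3)[OF that(1) h] by linarith
    next
      case h: False
      have "\<gamma> * (x - A T1) \<le> W x0 T1 / (q - A T1) * (q - A T1)" 
        using that e b True by (intro mult_mono) (auto simp: \<gamma>_def)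
      also have "\<dots> = W x0 T1" using b True by simp
      also have "\<dots> \<le> W x T1" using x0(2)[of x] h that by simp
      finally show ?thesis .
    qed
    then show ?thesis using \<gamma> unfolding T1_def by blast
  qed
qed

end

section \<open>The lower barrier for all late times\<close>

text \<open>The square root makes the second derivative of the profile \<open>y (1 + sqrt y - 2 y)\<close> blow up at 0,
  which absorbs the drift there; away from 0 the zeroth-order term with coefficient \<open>\<gamma>\<close> does, and near
  the zero \<open>y = 1\<close> the drift has the favourable sign.\<close>

lemma profile_strict_inequality:
  fixes y d l \<gamma> :: real
  assumes y: "0 < y" "y < 1" and d: "0 < d" and l: "12 * d \<le> l"
    and \<gamma>: "2 * (4 * d + 2 * l + 1) ^ 3 \<le> \<gamma> * (3 / 4 * d)\<^sup>2"
  shows "l * (1 + 3 / 2 * sqrt y - 4 * y) < \<gamma> * (y * (1 + sqrt y - 2 * y)) + d * (3 / (4 * sqrt y) - 4)"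
proof -
  define r where "r = sqrt y"
  have r: "0 < r" "r < 1" "y = r\<^sup>2" using y by (auto simp: r_def real_sqrt_lt_1_iff)
  define S where "S = 4 * d + 2 * l + 1"
  have S: "S > 0" using d l by (simp add: S_def)
  have \<gamma>0: "0 < \<gamma>"
  proof (rule ccontr)
    assume "\<not> 0 < \<gamma>"
    then have "\<gamma> * (3 / 4 * d)\<^sup>2 \<le> 0" by (simp add: mult_nonpos_nonneg)
    moreover have "0 < 2 * S ^ 3" using S by simp
    ultimately show False using \<gamma>[folded S_def] by linarith
  qed
  have fac: "1 + r - 2 * r\<^sup>2 = (1 - r) * (1 + 2 * r)" by (simp add: power2_eq_square algebra_simps)
  show ?thesis
  proof (cases "4 / 5 \<le> r")
    case True
    have "(r - 4 / 5) * (4 * r + 17 / 10) \<ge> 0" using True by simp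
    moreover have "(r - 4 / 5) * (4 * r + 17 / 10) = 4 * r\<^sup>2 - 3 / 2 * r - 34 / 25"
      by (simp add: power2_eq_square field_simps)
    ultimately have "1 + 3 / 2 * r - 4 * r\<^sup>2 \<le> - (9 / 25)" by linarith
    then have "l * (1 + 3 / 2 * r - 4 * r\<^sup>2) \<le> l * (- (9 / 25))" using l d by (intro mult_left_mono) auto
    also have "\<dots> < d * (3 / 4 - 4)" using l d by simp
    also have "\<dots> \<le> d * (3 / (4 * r) - 4)" using r d by (simp add: field_simps)
    also have "\<dots> \<le> \<gamma> * (r\<^sup>2 * (1 + r - 2 * r\<^sup>2)) + d * (3 / (4 * r) - 4)"
      using \<gamma>0 r unfolding fac by simp
    finally show ?thesis using r(3) unfolding r_def[symmetric] by simp
  next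
    case False
    have "1 / 2 \<le> 1 + r - 2 * r\<^sup>2"
    proof -
      have "0 \<le> r * (4 / 5 - r)" "0 \<le> (4 / 5 - r)" using False r by auto
      then show ?thesis by (simp add: power2_eq_square algebra_simps)
    qed
    then have "r\<^sup>2 * (1 / 2) \<le> r\<^sup>2 * (1 + r - 2 * r\<^sup>2)" by (intro mult_left_mono) auto
    then have \<phi>: "\<gamma> * (r\<^sup>2 / 2) \<le> \<gamma> * (r\<^sup>2 * (1 + r - 2 * r\<^sup>2))" using \<gamma>0 by (intro mult_left_mono) auto
    have "0 \<le> 4 * (r - 3 / 16)\<^sup>2" by simp
    then have "1 + 3 / 2 * r - 4 * r\<^sup>2 \<le> 2" by (simp add: power2_eq_square algebra_simps)
    then have L: "l * (1 + 3 / 2 * r - 4 * r\<^sup>2) \<le> l * 2" using l d by (intro mult_left_mono) auto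
    have "S \<le> \<gamma> * (r\<^sup>2 / 2) + d * (3 / (4 * r))"
    proof (cases "r * S \<le> 3 / 4 * d")
      case True
      then have "S \<le> d * (3 / (4 * r))" using r by (simp add: field_simps)
      then show ?thesis using \<gamma>0 by (simp add: add_increasing)
    next
      case False
      then have "(3 / 4 * d)\<^sup>2 \<le> (r * S)\<^sup>2" using d by (intro power_mono) auto
      then have "\<gamma> * (3 / 4 * d)\<^sup>2 \<le> \<gamma> * (r * S)\<^sup>2" using \<gamma>0 by simp
      then have "2 * S ^ 3 \<le> \<gamma> * (r * S)\<^sup>2" using \<gamma> by (simp add: S_def)
      then have "S\<^sup>2 * (2 * S) \<le> S\<^sup>2 * (\<gamma> * r\<^sup>2)" by (simp add: power2_eq_square power3_eq_cube algebra_simps)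
      then have "2 * S \<le> \<gamma> * r\<^sup>2" using S by simp
      moreover have "0 \<le> d * (3 / (4 * r))" using d r by simp
      ultimately show ?thesis by linarith
    qed
    then have "l * 2 < \<gamma> * (r\<^sup>2 / 2) + d * (3 / (4 * r) - 4)" by (simp add: S_def algebra_simps)
    then show ?thesis using \<phi> L unfolding r_def[symmetric] unfolding r(3) by linarith
  qed
qed

context strip_solution
begin

text \<open>The profile lives on a window of constant width \<kappa> in z and vanishes at both ends,
  so at the inner end only W \<ge> 0 is used. Its amplitude decays in s at the rate sqrt \<tau>, the
  \<gamma> of the profile inequality. The hypotheses \<open>drift\<close> say that the drift is
  large compared with the diffusion, yet its cube is small compared with sqrt \<tau>.\<close>

lemma late_lower_bound:
  assumes T1: "0 < T1" and \<kappa>: "0 < \<kappa>" and \<beta>: "0 < \<beta>"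
    and fits: "\<And>t. T1 \<le> t \<Longrightarrow> A t + \<kappa> * (t + 1) \<le> - A t"
    and drift: "\<And>t. T1 \<le> t \<Longrightarrow> 12 * (D / \<kappa>\<^sup>2) \<le> (A t - (t + 1) * A' t) / \<kappa>"
      "\<And>t. T1 \<le> t \<Longrightarrow> 2 * (4 * (D / \<kappa>\<^sup>2) + 2 * ((A t - (t + 1) * A' t) / \<kappa>) + 1) ^ 3 \<le> sqrt (t + 1) * (3 / 4 * (D / \<kappa>\<^sup>2))\<^sup>2"
    and init: "\<And>x. \<lbrakk>A T1 \<le> x; x \<le> A T1 + \<kappa> * (T1 + 1)\<rbrakk> \<Longrightarrow> \<beta> * ((x - A T1) / (\<kappa> * (T1 + 1))) \<le> W x T1"
    and tx: "T1 \<le> t" "A t \<le> x" "x \<le> A t + \<kappa> * (t + 1) / 4"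
  shows "\<beta> / (4 * exp 2) * ((x - A t) / (\<kappa> * (t + 1))) \<le> W x t"
proof -
  define \<phi> \<phi>' \<phi>'' :: "real \<Rightarrow> real" where "\<phi> y = y * (1 + sqrt y - 2 * y)"
    and "\<phi>' y = 1 + 3 / 2 * sqrt y - 4 * y" and "\<phi>'' y = 3 / (4 * sqrt y) - 4" for y
  have \<phi>_deriv: "(\<phi> has_real_derivative \<phi>' y) (at y)" "(\<phi>' has_real_derivative \<phi>'' y) (at y)" if "0 < y" for y
  proof -
    have s: "y = sqrt y * sqrt y" "sqrt y > 0" using that by auto
    have "(\<phi> has_real_derivative (1 + sqrt y - 2 * y) + y * (1 / (2 * sqrt y) - 2)) (at y)"
      unfolding \<phi>_def[abs_def] using that by (auto intro!: derivative_eq_intros simp: field_simps)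
    moreover have "(1 + sqrt y - 2 * y) + y * (1 / (2 * sqrt y) - 2) = \<phi>' y"
      using s by (simp add: \<phi>'_def field_simps)
    ultimately show "(\<phi> has_real_derivative \<phi>' y) (at y)" by simp
    show "(\<phi>' has_real_derivative \<phi>'' y) (at y)" unfolding \<phi>'_def[abs_def] \<phi>''_def
      using that by (auto intro!: derivative_eq_intros simp: field_simps)
  qed
  define Y where "Y x s = (x - A s) / (\<kappa> * (s + 1))" for x s
  \<comment> \<open>The profile is at most 2 y on [0, 1] and the exponential in \<open>E\<close>
    lies between 1 and exp 2, so this \<open>b\<close> puts the barrier below the initial data. For
    y \<le> 1/4 the profile is at least y / 2, whence the final 4 exp 2.\<close>
  define b where "b = \<beta> / (2 * exp 2)"
  have b: "b > 0" using \<beta> by (simp add: b_def)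
  define E where "E s = b * exp (2 / sqrt (s + 1))" for s
  define B where "B x s = E s * \<phi> (Y x s)" for x s
  have E: "b \<le> E s" "E s \<le> \<beta> / 2" "0 < E s" if "0 < s" for s
  proof -
    have "2 / sqrt (s + 1) \<le> 2" using that by (simp add: divide_le_eq)
    then have "exp (2 / sqrt (s + 1)) \<le> exp 2" by simp
    then have "b * exp (2 / sqrt (s + 1)) \<le> b * exp 2" using b by (intro mult_left_mono) auto
    then show "E s \<le> \<beta> / 2" unfolding E_def by (simp add: b_def)
    show "b \<le> E s" "0 < E s" using b that by (auto simp: E_def)
  qed
  have Y01: "0 < Y x s" "Y x s < 1" if "T1 < s" "A s < x" "x < A s + \<kappa> * (s + 1)" for x s
    using that T1 \<kappa> by (auto simp: Y_def divide_simps)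
  have "1 * B x t \<le> 1 * W x t"
  proof (rule comparison[where B = B and p = A and q = "\<lambda>t. A t + \<kappa> * (t + 1)" and ?T0.0 = T1 and ?T1.0 = t
      and Bt = "\<lambda>x s. - E s / ((s + 1) * sqrt (s + 1)) * \<phi> (Y x s)
        + E s * (\<phi>' (Y x s) * (- A' s / (\<kappa> * (s + 1)) - (x - A s) / (\<kappa> * (s + 1)\<^sup>2)))"
      and Bx = "\<lambda>x s. E s * \<phi>' (Y x s) / (\<kappa> * (s + 1))" and Bxx = "\<lambda>x s. E s * \<phi>'' (Y x s) / (\<kappa> * (s + 1))\<^sup>2"])
    show "continuous_on {T1..t} A" "continuous_on {T1..t} (\<lambda>t. A t + \<kappa> * (t + 1))"
      using A_cont_Icc[OF T1] by (auto intro!: continuous_intros)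
    show "continuous_on {(x, s). T1 \<le> s \<and> s \<le> t \<and> A s \<le> x \<and> x \<le> A s + \<kappa> * (s + 1)} (\<lambda>(x, s). B x s)"
      unfolding B_def E_def Y_def \<phi>_def case_prod_unfold using T1 \<kappa>
      by (auto intro!: continuous_intros continuous_on_compose2[OF A_cont])
  next
    fix x s assume h: "T1 < s" "s \<le> t" "A s < x" "x < A s + \<kappa> * (s + 1)"
    define \<tau> where "\<tau> = s + 1"
    have \<tau>: "\<tau> > 0" "sqrt \<tau> > 0" "sqrt \<tau> * sqrt \<tau> = \<tau>" using h T1 by (auto simp: \<tau>_def)
    have Yt: "((\<lambda>s. Y x s) has_real_derivative - A' s / (\<kappa> * (s + 1)) - (x - A s) / (\<kappa> * (s + 1)\<^sup>2)) (at s)"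
      unfolding Y_def using h T1 \<kappa>
      by (auto intro!: derivative_eq_intros A_deriv simp: divide_simps power2_eq_square) (auto simp: algebra_simps)
    have Yx: "((\<lambda>z. Y z s) has_real_derivative 1 / (\<kappa> * (s + 1))) (at x)"
      unfolding Y_def using h T1 \<kappa> by (auto intro!: derivative_eq_intros)
    have Et: "(E has_real_derivative - E s / ((s + 1) * sqrt (s + 1))) (at s)"
      unfolding E_def[abs_def]
      by (rule derivative_eq_intros refl | use h T1 in \<open>simp add: divide_simps\<close>)+
    note y = Y01[OF h(1,3,4)]
    note [derivative_intros] = Et DERIV_chain2[OF \<phi>_deriv(1)[OF y(1)] Yt] DERIV_chain2[OF \<phi>_deriv(1)[OF y(1)] Yx]
      DERIV_chain2[OF \<phi>_deriv(2)[OF y(1)] Yx]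
    show "((\<lambda>s. B x s) has_real_derivative - E s / ((s + 1) * sqrt (s + 1)) * \<phi> (Y x s)
        + E s * (\<phi>' (Y x s) * (- A' s / (\<kappa> * (s + 1)) - (x - A s) / (\<kappa> * (s + 1)\<^sup>2)))) (at s)"
      "((\<lambda>z. B z s) has_real_derivative E s * \<phi>' (Y x s) / (\<kappa> * (s + 1))) (at x)"
      unfolding B_def by (auto intro!: derivative_eq_intros)
    show "((\<lambda>z. E s * \<phi>' (Y z s) / (\<kappa> * (s + 1))) has_real_derivative E s * \<phi>'' (Y x s) / (\<kappa> * (s + 1))\<^sup>2) (at x)"
      using h T1 \<kappa> by (auto intro!: derivative_eq_intros simp: power2_eq_square)
    define l where "l = (A s - \<tau> * A' s) / \<kappa>"
    define d where "d = D / \<kappa>\<^sup>2"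
    have "l * \<phi>' (Y x s) < sqrt \<tau> * \<phi> (Y x s) + d * \<phi>'' (Y x s)"
      unfolding \<phi>_def \<phi>'_def \<phi>''_def
    proof (rule profile_strict_inequality[OF y])
      show "0 < d" using D_pos \<kappa> by (simp add: d_def)
      show "12 * d \<le> l" "2 * (4 * d + 2 * l + 1) ^ 3 \<le> sqrt \<tau> * (3 / 4 * d)\<^sup>2"
        using drift[of s] h by (auto simp: d_def l_def \<tau>_def)
    qed
    then have "E s / \<tau>\<^sup>2 * (l * \<phi>' (Y x s) - sqrt \<tau> * \<phi> (Y x s) - d * \<phi>'' (Y x s)) < 0"
      using E[of s] h T1 \<tau> by (intro mult_pos_neg) auto
    also have "E s / \<tau>\<^sup>2 * (l * \<phi>' (Y x s) - sqrt \<tau> * \<phi> (Y x s) - d * \<phi>'' (Y x s))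
       = 1 * ((- E s / (\<tau> * sqrt \<tau>) * \<phi> (Y x s)
          + E s * (\<phi>' (Y x s) * (- A' s / (\<kappa> * \<tau>) - (x - A s) / (\<kappa> * \<tau>\<^sup>2))))
          - D * (E s * \<phi>'' (Y x s) / (\<kappa> * \<tau>)\<^sup>2) + x / \<tau> * (E s * \<phi>' (Y x s) / (\<kappa> * \<tau>)))"
    proof -
      have "E s / \<tau>\<^sup>2 * (sqrt \<tau> * \<phi> (Y x s)) = E s / (\<tau> * sqrt \<tau>) * \<phi> (Y x s)"
        using \<tau> by (simp add: divide_simps power2_eq_square)
      moreover have "E s / \<tau>\<^sup>2 * (d * \<phi>'' (Y x s)) = D * (E s * \<phi>'' (Y x s) / (\<kappa> * \<tau>)\<^sup>2)"
        using \<tau> \<kappa> by (simp add: d_def field_simps)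
      moreover have "E s / \<tau>\<^sup>2 * (l * \<phi>' (Y x s)) = E s * (\<phi>' (Y x s) * (- A' s / (\<kappa> * \<tau>) - (x - A s) / (\<kappa> * \<tau>\<^sup>2)))
          + x / \<tau> * (E s * \<phi>' (Y x s) / (\<kappa> * \<tau>))"
        using \<tau> \<kappa> by (simp add: l_def divide_simps power2_eq_square) (simp add: algebra_simps)
      ultimately show ?thesis by (simp add: right_diff_distrib)
    qed
    finally show "1 * ((- E s / ((s + 1) * sqrt (s + 1)) * \<phi> (Y x s)
          + E s * (\<phi>' (Y x s) * (- A' s / (\<kappa> * (s + 1)) - (x - A s) / (\<kappa> * (s + 1)\<^sup>2))))
          - D * (E s * \<phi>'' (Y x s) / (\<kappa> * (s + 1))\<^sup>2) + x / (s + 1) * (E s * \<phi>' (Y x s) / (\<kappa> * (s + 1)))) < 0"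
      unfolding \<tau>_def .
  next
    fix x assume h: "A T1 \<le> x" "x \<le> A T1 + \<kappa> * (T1 + 1)"
    have y: "0 \<le> Y x T1" "Y x T1 \<le> 1" using h T1 \<kappa> by (auto simp: Y_def divide_simps)
    then have "sqrt (Y x T1) \<le> 1" by simp
    then have "1 + sqrt (Y x T1) - 2 * Y x T1 \<le> 2" using y(1) by linarith
    then have "\<phi> (Y x T1) \<le> Y x T1 * 2" unfolding \<phi>_def using y(1) by (rule mult_left_mono)
    then have "B x T1 \<le> E T1 * (Y x T1 * 2)" using E(3)[OF T1] by (simp add: B_def)
    also have "\<dots> \<le> \<beta> / 2 * (Y x T1 * 2)" using E(2)[OF T1] y by (intro mult_right_mono) auto
    also have "\<dots> = \<beta> * Y x T1" by simp
    also have "\<dots> \<le> W x T1" using init[OF h] unfolding Y_def .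
    finally show "1 * B x T1 \<le> 1 * W x T1" by simp
  next
    fix s assume h: "T1 \<le> s" "s \<le> t"
    show "1 * B (A s) s \<le> 1 * W (A s) s" using W_bdry(1)[of s] h T1 by (simp add: B_def Y_def \<phi>_def)
    have "Y (A s + \<kappa> * (s + 1)) s = 1" using h T1 \<kappa> by (simp add: Y_def)
    then have "B (A s + \<kappa> * (s + 1)) s = 0" by (simp add: B_def \<phi>_def)
    then show "1 * B (A s + \<kappa> * (s + 1)) s \<le> 1 * W (A s + \<kappa> * (s + 1)) s"
      using W_nonneg[of s "A s + \<kappa> * (s + 1)"] fits[of s] h T1 \<kappa> by simp
  next
    show "x \<le> A t + \<kappa> * (t + 1)" using tx T1 \<kappa> by (simp add: mult_nonneg_nonneg add_increasing2)
  qed (use T1 fits tx in auto)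
  moreover have "\<beta> / (4 * exp 2) * Y x t \<le> B x t"
  proof -
    have y: "0 \<le> Y x t" "Y x t \<le> 1 / 4" using tx T1 \<kappa> by (auto simp: Y_def divide_simps)
    have "0 \<le> sqrt (Y x t)" using y(1) by simp
    then have "1 / 2 \<le> 1 + sqrt (Y x t) - 2 * Y x t" using y(2) by linarith
    then have "Y x t * (1 / 2) \<le> \<phi> (Y x t)" unfolding \<phi>_def using y(1) by (rule mult_left_mono)
    then have "b * (Y x t * (1 / 2)) \<le> E t * \<phi> (Y x t)"
      using E(1,3)[of t] tx T1 b y by (intro mult_mono) auto
    then show ?thesis by (simp add: B_def b_def)
  qed
  ultimately show ?thesis by (simp add: Y_def)
qed

end

section \<open>The Gaussian factor\<close>

lemma heat_kernel_factor:
  fixes D c f\<^sub>0 \<tau> \<alpha> e x :: real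
  assumes "D > 0" and "c\<^sup>2 = 4 * D * f\<^sub>0" and "\<tau> > 0" and x: "x = - c * \<tau> + (\<alpha> * ln \<tau> + e)"
  shows "sqrt \<tau> * exp (x\<^sup>2 / (4 * D * \<tau>) - f\<^sub>0 * (\<tau> - 1))
    = \<tau> powr (1 / 2 - \<alpha> * c / (2 * D)) * exp (f\<^sub>0 - c * e / (2 * D) + (\<alpha> * ln \<tau> + e)\<^sup>2 / (4 * D * \<tau>))"
proof -
  define a where "a = \<alpha> * ln \<tau> + e"
  have "x\<^sup>2 / (4 * D * \<tau>) = (c\<^sup>2 * \<tau>\<^sup>2 - 2 * c * a * \<tau> + a\<^sup>2) / (4 * D * \<tau>)"
    unfolding x[folded a_def] by (simp add: power2_eq_square algebra_simps)
  also have "\<dots> = f\<^sub>0 * \<tau> - c * a / (2 * D) + a\<^sup>2 / (4 * D * \<tau>)"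
    unfolding assms(2) using assms(1,3) by (simp add: divide_simps power2_eq_square) (simp add: algebra_simps)
  finally have "x\<^sup>2 / (4 * D * \<tau>) = f\<^sub>0 * \<tau> - c * a / (2 * D) + a\<^sup>2 / (4 * D * \<tau>)" .
  moreover have "sqrt \<tau> = exp (ln \<tau> / 2)" using assms(3) by (simp add: ln_sqrt[symmetric])
  moreover have "c * a / (2 * D) = \<alpha> * c / (2 * D) * ln \<tau> + c * e / (2 * D)"
    by (simp add: a_def algebra_simps add_divide_distrib)
  ultimately show ?thesis
    unfolding a_def[symmetric] using assms(3) by (simp add: powr_def mult_exp_exp algebra_simps)
qed

lemma powr_shift_bounds:
  fixes t q :: real
  assumes "t \<ge> 1"
  shows "2 powr (- \<bar>q\<bar>) * t powr q \<le> (t + 1) powr q" "(t + 1) powr q \<le> 2 powr \<bar>q\<bar> * t powr q"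
proof -
  define r where "r = (t + 1) / t"
  have r: "1 \<le> r" "r \<le> 2" and t: "t + 1 = r * t" using assms by (auto simp: r_def field_simps)
  have "r powr q \<le> r powr \<bar>q\<bar>" "r powr (- \<bar>q\<bar>) \<le> r powr q" using r by (auto intro!: powr_mono)
  moreover have "r powr \<bar>q\<bar> \<le> 2 powr \<bar>q\<bar>" using r by (intro powr_mono2) auto
  moreover have "2 powr (- \<bar>q\<bar>) \<le> r powr (- \<bar>q\<bar>)" using r by (intro powr_mono2') auto
  ultimately have "2 powr (- \<bar>q\<bar>) \<le> r powr q" "r powr q \<le> 2 powr \<bar>q\<bar>" by linarith+
  moreover have "(t + 1) powr q = r powr q * t powr q" using r assms by (simp add: t powr_mult)
  ultimately show "2 powr (- \<bar>q\<bar>) * t powr q \<le> (t + 1) powr q" "(t + 1) powr q \<le> 2 powr \<bar>q\<bar> * t powr q"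
    by (auto intro: mult_right_mono)
qed

text \<open>The multiplier is the reciprocal of the Gaussian solution on the whole line. It removes
  the reaction term, and its logarithmic derivative x / (2 D (t + 1)) in x produces the
  drift.\<close>

lemma strip_solution_of_dirichlet_solution:
  fixes D f\<^sub>0 :: real and A A' L :: "real \<Rightarrow> real" and \<psi> :: "real \<Rightarrow> real \<Rightarrow> real"
  assumes D: "D > 0" and AL: "\<And>t. t \<ge> 0 \<Longrightarrow> A t = - L t / 2" "\<And>t. t \<ge> 0 \<Longrightarrow> L t > 0"
    and A': "\<And>t. t > 0 \<Longrightarrow> (A has_real_derivative A' t) (at t)" "continuous_on {0<..} A'"
    and sol: "dirichlet_solution D f\<^sub>0 A L \<psi>"
    and nonneg: "\<And>x t. (x, t) \<in> closed_domain A L \<Longrightarrow> \<psi> x t \<ge> 0"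
  shows "\<exists>Wt Wx Wxx. strip_solution D A A'
    (\<lambda>x t. \<psi> x t * (sqrt (t + 1) * exp (x\<^sup>2 / (4 * D * (t + 1)) - f\<^sub>0 * t))) Wt Wx Wxx"
proof -
  have AL': "A t + L t = - A t" if "t \<ge> 0" for t using AL[OF that] by simp
  have open_iff: "(x, t) \<in> open_domain A L \<longleftrightarrow> 0 < t \<and> A t < x \<and> x < - A t" for x t
    using AL'[of t] by (auto simp: open_domain_def)
  have closed_iff: "(x, t) \<in> closed_domain A L \<longleftrightarrow> 0 < t \<and> A t \<le> x \<and> x \<le> - A t" for x t
    using AL'[of t] by (auto simp: closed_domain_def)
  have closed_eq: "closed_domain A L = {(x, t). 0 < t \<and> A t \<le> x \<and> x \<le> - A t}"
    using closed_iff by auto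
  obtain \<psi>t \<psi>x \<psi>xx where der: "\<And>x t. (x, t) \<in> open_domain A L \<Longrightarrow>
           ((\<lambda>s. \<psi> x s) has_real_derivative \<psi>t x t) (at t) \<and>
           ((\<lambda>z. \<psi> z t) has_real_derivative \<psi>x x t) (at x) \<and>
           ((\<lambda>z. \<psi>x z t) has_real_derivative \<psi>xx x t) (at x) \<and>
           \<psi>t x t = D * \<psi>xx x t + f\<^sub>0 * \<psi> x t"
    using sol unfolding dirichlet_solution_def by blast
  define H where "H x t = sqrt (t + 1) * exp (x\<^sup>2 / (4 * D * (t + 1)) - f\<^sub>0 * t)" for x t
  define Ht where "Ht x t = H x t * (1 / (2 * (t + 1)) - x\<^sup>2 / (4 * D * (t + 1)\<^sup>2) - f\<^sub>0)" for x t
  define Hx where "Hx x t = H x t * (x / (2 * D * (t + 1)))" for x t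
  define Hxx where "Hxx x t = H x t * (1 / (2 * D * (t + 1)) + (x / (2 * D * (t + 1)))\<^sup>2)" for x t
  have H_t: "((\<lambda>s. H x s) has_real_derivative Ht x t) (at t)" if "t > 0" for x t
  proof -
    have "((\<lambda>s. x\<^sup>2 / (4 * D * (s + 1)) - f\<^sub>0 * s) has_real_derivative
        - x\<^sup>2 / (4 * D * (t + 1)\<^sup>2) - f\<^sub>0) (at t)"
      using that D by (auto intro!: derivative_eq_intros simp: power2_eq_square)
    moreover have "((\<lambda>s. sqrt (s + 1)) has_real_derivative 1 / (2 * sqrt (t + 1))) (at t)"
      using that by (auto intro!: derivative_eq_intros simp: field_simps)
    ultimately have "((\<lambda>s. H x s) has_real_derivative (1 / (2 * sqrt (t + 1))) * exp (x\<^sup>2 / (4 * D * (t + 1)) - f\<^sub>0 * t)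
      + exp (x\<^sup>2 / (4 * D * (t + 1)) - f\<^sub>0 * t) * (- x\<^sup>2 / (4 * D * (t + 1)\<^sup>2) - f\<^sub>0) * sqrt (t + 1)) (at t)"
      unfolding H_def by (intro DERIV_mult DERIV_fun_exp)
    moreover have "1 / (2 * sqrt (t + 1)) = sqrt (t + 1) * (1 / (2 * (t + 1)))"
      using that by (simp add: field_simps)
    moreover have "sqrt (t + 1) * (1 / (2 * (t + 1))) * exp (x\<^sup>2 / (4 * D * (t + 1)) - f\<^sub>0 * t)
        + exp (x\<^sup>2 / (4 * D * (t + 1)) - f\<^sub>0 * t) * (- x\<^sup>2 / (4 * D * (t + 1)\<^sup>2) - f\<^sub>0) * sqrt (t + 1) = Ht x t"
      unfolding Ht_def H_def by (simp add: algebra_simps)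
    ultimately show ?thesis by metis
  qed
  have H_x: "((\<lambda>z. H z t) has_real_derivative Hx x t) (at x)" if "t > 0" for x t
  proof -
    have "((\<lambda>z. z\<^sup>2 / (4 * D * (t + 1)) - f\<^sub>0 * t) has_real_derivative x / (2 * D * (t + 1))) (at x)"
      using that D by (auto intro!: derivative_eq_intros simp: divide_simps)
    from DERIV_cmult[OF DERIV_fun_exp[OF this], of "sqrt (t + 1)"] show ?thesis
      unfolding H_def Hx_def by (simp add: mult.assoc)
  qed
  have H_xx: "((\<lambda>z. Hx z t) has_real_derivative Hxx x t) (at x)" if "t > 0" for x t
  proof -
    have "((\<lambda>z. z / (2 * D * (t + 1))) has_real_derivative 1 / (2 * D * (t + 1))) (at x)"
      using DERIV_cdivide[OF DERIV_ident] .
    from DERIV_mult[OF H_x[OF that, of x] this] show ?thesis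
      unfolding Hx_def Hxx_def by (simp add: power2_eq_square distrib_left mult.assoc mult.left_commute add.commute)
  qed
  have "strip_solution D A A' (\<lambda>x t. \<psi> x t * H x t) (\<lambda>x t. \<psi>t x t * H x t + \<psi> x t * Ht x t)
    (\<lambda>x t. \<psi>x x t * H x t + \<psi> x t * Hx x t)
    (\<lambda>x t. \<psi>xx x t * H x t + 2 * (\<psi>x x t * Hx x t) + \<psi> x t * Hxx x t)"
  proof
    show "continuous_on {(x, t). 0 < t \<and> A t \<le> x \<and> x \<le> - A t} (\<lambda>(x, t). \<psi> x t * H x t)"
    proof -
      have "continuous_on {(x, t). 0 < t \<and> A t \<le> x \<and> x \<le> - A t} (\<lambda>(x, t). H x t)"
        unfolding H_def case_prod_unfold using D by (auto intro!: continuous_intros)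
      moreover have "continuous_on {(x, t). 0 < t \<and> A t \<le> x \<and> x \<le> - A t} (\<lambda>(x, t). \<psi> x t)"
        using sol unfolding dirichlet_solution_def closed_eq by blast
      ultimately show ?thesis using continuous_on_mult by (fastforce simp: case_prod_unfold)
    qed
  next
    fix x t assume h: "0 < t" "A t < x" "x < - A t"
    then have d: "((\<lambda>s. \<psi> x s) has_real_derivative \<psi>t x t) (at t)"
           "((\<lambda>z. \<psi> z t) has_real_derivative \<psi>x x t) (at x)"
           "((\<lambda>z. \<psi>x z t) has_real_derivative \<psi>xx x t) (at x)"
           "\<psi>t x t = D * \<psi>xx x t + f\<^sub>0 * \<psi> x t"
      using der[of x t] open_iff[of x t] by auto
    note [derivative_intros] = d(1-3) H_t[OF h(1)] H_x[OF h(1)] H_xx[OF h(1)]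
    show "((\<lambda>s. \<psi> x s * H x s) has_real_derivative \<psi>t x t * H x t + \<psi> x t * Ht x t) (at t)"
      "((\<lambda>z. \<psi> z t * H z t) has_real_derivative \<psi>x x t * H x t + \<psi> x t * Hx x t) (at x)"
      "((\<lambda>z. \<psi>x z t * H z t + \<psi> z t * Hx z t) has_real_derivative
        \<psi>xx x t * H x t + 2 * (\<psi>x x t * Hx x t) + \<psi> x t * Hxx x t) (at x)"
      by (auto intro!: derivative_eq_intros simp: algebra_simps)
    \<comment> \<open>The first identity settles the terms carrying \<psi>; the second turns the
      cross term 2 D \<psi>x Hx of the product rule into the \<psi>x part of the drift.\<close>
    have "Ht x t = D * Hxx x t - f\<^sub>0 * H x t - x / (t + 1) * Hx x t"
      unfolding Ht_def Hxx_def Hx_def using h D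
      by (simp add: divide_simps power2_eq_square) (simp add: algebra_simps)
    moreover have "2 * D * Hx x t = x / (t + 1) * H x t"
      unfolding Hx_def using h D by (simp add: divide_simps)
    ultimately show "\<psi>t x t * H x t + \<psi> x t * Ht x t
        = D * (\<psi>xx x t * H x t + 2 * (\<psi>x x t * Hx x t) + \<psi> x t * Hxx x t)
          - x / (t + 1) * (\<psi>x x t * H x t + \<psi> x t * Hx x t)"
      unfolding d(4) by algebra
  next
    fix x t assume "0 < t" "A t \<le> x" "x \<le> - A t"
    then show "0 \<le> \<psi> x t * H x t" using nonneg[of x t] closed_iff by (auto simp: H_def)
  next
    fix t :: real assume "0 < t"
    then have "\<psi> (A t) t = 0 \<and> \<psi> (A t + L t) t = 0" "A t + L t = - A t"
      using sol AL'[of t] unfolding dirichlet_solution_def by auto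
    then show "\<psi> (A t) t * H (A t) t = 0" "\<psi> (- A t) t * H (- A t) t = 0" by simp_all
  next
    fix t :: real assume "0 \<le> t"
    then show "A t < 0" using AL[of t] by simp
  qed (use D A' in auto)
  then show ?thesis unfolding H_def by blast
qed

section \<open>Two-sided bounds near the boundary and conclusion\<close>

context strip_solution
begin

text \<open>Since \<alpha> > 0, the drift \<alpha> ln (t + 1) + O(1) eventually exceeds any
  constant, while its cube stays below any multiple of sqrt (t + 1). The lower barrier is used with
  \<kappa> = c, half the limiting width of the strip in z.\<close>

lemma W_boundary_asymptotics:
  fixes c \<alpha> E :: real
  assumes c: "c > 0" and \<alpha>: "\<alpha> > 0" and Ta: "Ta \<ge> 1"
    and A_le: "\<And>t. t \<ge> Ta \<Longrightarrow> A t \<le> - c * t + \<alpha> * ln (t + 1) + E"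
    and \<Lambda>: "\<And>t. t \<ge> Ta \<Longrightarrow> \<bar>A t - (t + 1) * A' t - \<alpha> * ln (t + 1)\<bar> \<le> R"
    and pos: "0 < t0" "A t0 < x0" "x0 < - A t0" "0 < W x0 t0"
  shows "\<exists>m M T. 0 < m \<and> 0 < M \<and> 1 \<le> T \<and> (\<forall>t\<ge>T. \<forall>y. 0 \<le> y \<and> y \<le> c * (t + 1) / 4 \<longrightarrow> 
    m * (y / (t + 1)) \<le> W (A t + y) t \<and> W (A t + y) t \<le> M * (y / (t + 1)))"
proof -
  define \<Lambda> where "\<Lambda> t = A t - (t + 1) * A' t" for t
  define d where "d = D / c\<^sup>2"
  have d: "d > 0" using D_pos c by (simp add: d_def)
  have "\<forall>\<^sub>F t in at_top. - 2 * c * t + 2 * \<alpha> * ln (t + 1) + 2 * E + c * (t + 1) < 0"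
    using c \<alpha> by real_asymp
  moreover have "\<forall>\<^sub>F t in at_top. 12 * d * c < \<alpha> * ln (t + 1) - R"
    using \<alpha> by real_asymp
  moreover have "\<forall>\<^sub>F t in at_top. 2 * (4 * d + 2 * ((\<alpha> * ln (t + 1) + R) / c) + 1) ^ 3 < sqrt (t + 1) * (3 / 4 * d)\<^sup>2"
    using \<alpha> c d by real_asymp
  ultimately have "\<forall>\<^sub>F t in at_top. - 2 * c * t + 2 * \<alpha> * ln (t + 1) + 2 * E + c * (t + 1) < 0 \<and>
     12 * d * c < \<alpha> * ln (t + 1) - R \<and>
     2 * (4 * d + 2 * ((\<alpha> * ln (t + 1) + R) / c) + 1) ^ 3 < sqrt (t + 1) * (3 / 4 * d)\<^sup>2"
    by (intro eventually_conj)
  then obtain Tb where Tb: "\<And>t. t \<ge> Tb \<Longrightarrow> - 2 * c * t + 2 * \<alpha> * ln (t + 1) + 2 * E + c * (t + 1) < 0 \<and>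
     12 * d * c < \<alpha> * ln (t + 1) - R \<and>
     2 * (4 * d + 2 * ((\<alpha> * ln (t + 1) + R) / c) + 1) ^ 3 < sqrt (t + 1) * (3 / 4 * d)\<^sup>2"
    unfolding eventually_at_top_linorder by blast
  \<comment> \<open>\<open>T0\<close> lies beyond \<open>t0\<close>, so W is already positive
    throughout the strip; the unit step to \<open>T1\<close> is the regularisation time of both
    bounds.\<close>
  define T0 where "T0 = max (max Ta Tb) (t0 + 1)"
  define T1 where "T1 = T0 + 1"
  have T: "T0 \<ge> 1" "T0 \<ge> Ta" "T0 \<ge> Tb" "T0 > t0" using Ta by (auto simp: T0_def)
  have \<Lambda>1: "\<bar>\<Lambda> t - \<alpha> * ln (t + 1)\<bar> \<le> R" if "t \<ge> T0" for t using \<Lambda>[of t] that T by (simp add: \<Lambda>_def)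
  have fits: "A t + c * (t + 1) < - A t" if "t \<ge> T0" for t
    using A_le[of t] Tb[of t] that T by linarith
  have "- R \<le> A t - (t + 1) * A' t" if "T0 \<le> t" for t
  proof -
    have "0 \<le> \<alpha> * ln (t + 1)" using \<alpha> that T by simp
    then show ?thesis using \<Lambda>1[OF that] unfolding \<Lambda>_def by linarith
  qed
  from W_linear_upper_bound[OF _ this] T obtain N where N: "N > 0"
    "\<And>t x. t \<ge> T1 \<Longrightarrow> A t \<le> x \<Longrightarrow> x \<le> - A t \<Longrightarrow> W x t \<le> N * ((x - A t) / (t + 1))"
    unfolding T1_def by (metis less_le_trans zero_less_one)
  have Wpos: "0 < W x t" if "T0 \<le> t" "A t < x" "x < - A t" for x t
    using positivity_propagates[OF pos(1) _ pos(2-4)] that T by force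
  have q: "A T1 + c * (T1 + 1) < - A (T0 + 1)" using fits[of T1] by (simp add: T1_def)
  obtain \<beta>0 where b0: "\<beta>0 > 0" "\<And>x. A T1 \<le> x \<Longrightarrow> x \<le> A T1 + c * (T1 + 1) \<Longrightarrow> \<beta>0 * (x - A T1) \<le> W x T1"
    using linear_lower_bound_at_time[OF _ _ q] Wpos T unfolding T1_def by force
  define \<beta> where "\<beta> = \<beta>0 * (c * (T1 + 1))"
  have cT: "c * (T1 + 1) > 0" using c T by (simp add: T1_def)
  have \<beta>: "\<beta> > 0" using b0 cT by (simp add: \<beta>_def)
  have low: "\<beta> / (4 * exp 2) * ((x - A t) / (c * (t + 1))) \<le> W x t"
    if "T1 \<le> t" "A t \<le> x" "x \<le> A t + c * (t + 1) / 4" for x t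
  proof (rule late_lower_bound[OF _ c \<beta> _ _ _ _ that])
    fix s assume s: "T1 \<le> s"
    then have s': "T0 \<le> s" by (simp add: T1_def)
    show "A s + c * (s + 1) \<le> - A s" using fits[OF s'] by simp
    have tb: "12 * d * c < \<alpha> * ln (s + 1) - R"
      "2 * (4 * d + 2 * ((\<alpha> * ln (s + 1) + R) / c) + 1) ^ 3 < sqrt (s + 1) * (3 / 4 * d)\<^sup>2"
      using Tb[of s] s' T by auto
    have "12 * d * c \<le> \<Lambda> s" using tb(1) \<Lambda>1[OF s'] by linarith
    then have l: "12 * d \<le> \<Lambda> s / c" using c by (simp add: le_divide_eq)
    then show "12 * (D / c\<^sup>2) \<le> (A s - (s + 1) * A' s) / c" by (simp add: d_def \<Lambda>_def)
    have "\<Lambda> s \<le> \<alpha> * ln (s + 1) + R" using \<Lambda>1[OF s'] by linarith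
    then have "\<Lambda> s / c \<le> (\<alpha> * ln (s + 1) + R) / c" using c by (intro divide_right_mono) auto
    then have "(4 * d + 2 * (\<Lambda> s / c) + 1) ^ 3 \<le> (4 * d + 2 * ((\<alpha> * ln (s + 1) + R) / c) + 1) ^ 3"
      using l d by (intro power_mono) linarith+
    then have "2 * (4 * d + 2 * (\<Lambda> s / c) + 1) ^ 3 \<le> sqrt (s + 1) * (3 / 4 * d)\<^sup>2" using tb(2) by linarith
    then show "2 * (4 * (D / c\<^sup>2) + 2 * ((A s - (s + 1) * A' s) / c) + 1) ^ 3 \<le> sqrt (s + 1) * (3 / 4 * (D / c\<^sup>2))\<^sup>2"
      unfolding d_def \<Lambda>_def .
  next
    fix x assume x: "A T1 \<le> x" "x \<le> A T1 + c * (T1 + 1)"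
    have "\<beta>0 * K * ((x - A T1) / K) = \<beta>0 * (x - A T1)" if "0 < K" for K using that by simp
    from this[OF cT] show "\<beta> * ((x - A T1) / (c * (T1 + 1))) \<le> W x T1"
      using b0(2)[OF x] unfolding \<beta>_def by linarith
  qed (use T in \<open>auto simp: T1_def\<close>)
  define m where "m = \<beta> / (4 * exp 2) / c"
  have m: "m > 0" using \<beta> c by (simp add: m_def)
  have "m * (y / (t + 1)) \<le> W (A t + y) t \<and> W (A t + y) t \<le> N * (y / (t + 1))"
    if h: "T1 \<le> t" "0 \<le> y" "y \<le> c * (t + 1) / 4" for t y
  proof -
    have "A t + y \<le> - A t"
    proof -
      have "y \<le> c * (t + 1)" using h c T by (simp add: T1_def)
      then show ?thesis using fits[of t] h by (simp add: T1_def)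
    qed
    then have "W (A t + y) t \<le> N * (y / (t + 1))" using N(2)[of t "A t + y"] h by simp
    moreover have "m * (y / (t + 1)) \<le> W (A t + y) t"
      using low[OF h(1), of "A t + y"] h by (simp add: m_def)
    ultimately show ?thesis by blast
  qed
  then show ?thesis using m N(1) T by (intro exI[of _ m] exI[of _ N] exI[of _ T1]) (auto simp: T1_def)
qed

end

theorem theorem3p1:
  fixes D f\<^sub>0 c \<alpha> :: real
    and A L \<eta> \<eta>' \<eta>'' \<eta>''' :: "real \<Rightarrow> real"
    and \<psi> :: "real \<Rightarrow> real \<Rightarrow> real"
  assumes "D > 0" and "f\<^sub>0 > 0" and "c = 2 * sqrt (D * f\<^sub>0)" and "\<alpha> > 0"
    and "\<And>t. t \<ge> 0 \<Longrightarrow> A t = - c * t + \<alpha> * ln (t + 1) + \<eta> t"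
    and "\<And>t. t \<ge> 0 \<Longrightarrow> A t = - L t / 2"
    and "\<And>t. t \<ge> 0 \<Longrightarrow> L t > 0"
    and "\<And>t. t \<ge> 0 \<Longrightarrow> (\<eta> has_real_derivative \<eta>' t) (at t within {0..})"
    and "\<And>t. t \<ge> 0 \<Longrightarrow> (\<eta>' has_real_derivative \<eta>'' t) (at t within {0..})"
    and "\<And>t. t \<ge> 0 \<Longrightarrow> (\<eta>'' has_real_derivative \<eta>''' t) (at t within {0..})"
    and "\<eta> \<in> O[at_top](\<lambda>t. 1)"
    and "\<eta>' \<in> o[at_top](\<lambda>t. 1 / t)"
    and "\<eta>'' \<in> o[at_top](\<lambda>t. 1 / t ^ 2)"
    and "\<eta>''' \<in> o[at_top](\<lambda>t. 1 / t ^ 3)"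
    and "dirichlet_solution D f\<^sub>0 A L \<psi>"
    and "\<And>x t. (x, t) \<in> closed_domain A L \<Longrightarrow> \<psi> x t \<ge> 0"
    and "\<exists>(x, t) \<in> closed_domain A L. \<psi> x t \<noteq> 0"
  shows "\<forall>Y>0. \<exists>T>0. \<exists>\<beta>\<^sub>0 \<beta>\<^sub>1. 0 < \<beta>\<^sub>0 \<and> \<beta>\<^sub>0 \<le> \<beta>\<^sub>1 \<and>
    (\<forall>t\<ge>T. \<forall>y. 0 \<le> y \<and> y \<le> Y \<longrightarrow>
       \<beta>\<^sub>0 * (y * t powr (- 3 / 2 + \<alpha> * c / (2 * D))) \<le> \<psi> (A t + y) t \<and>
       \<psi> (A t + y) t \<le> \<beta>\<^sub>1 * (y * t powr (- 3 / 2 + \<alpha> * c / (2 * D))))"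
proof (intro allI impI)
  fix Y :: real assume Y: "Y > 0"
  note D = assms(1) and \<alpha> = assms(4) and A_eq = assms(5) and \<psi>_nonneg = assms(16)
  have c: "c > 0" "c\<^sup>2 = 4 * D * f\<^sub>0" using assms(1-3) by (auto simp: power_mult_distrib)
  define A' where "A' t = - c + \<alpha> / (t + 1) + \<eta>' t" for t
  have at_pos: "at t within {0..} = at t" if "t > 0" for t :: real
    using that by (intro at_within_interior) simp
  have A_deriv: "(A has_real_derivative A' t) (at t)" if "t > 0" for t
  proof -
    have "(\<eta> has_real_derivative \<eta>' t) (at t)" using assms(8)[of t] that by (simp add: at_pos)
    then have "((\<lambda>t. - c * t + \<alpha> * ln (t + 1) + \<eta> t) has_real_derivative A' t) (at t)"
      unfolding A'_def using that by (auto intro!: derivative_eq_intros)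
    then show ?thesis
      by (rule has_field_derivative_transform_within_open[of _ _ _ "{0<..}"]) (use that A_eq in auto)
  qed
  have "continuous_on {0..} \<eta>'" using assms(9) by (meson DERIV_continuous_on atLeast_iff)
  then have "continuous_on {0<..} \<eta>'" by (rule continuous_on_subset) auto
  then have A'_cont: "continuous_on {0<..} A'"
    unfolding A'_def by (auto intro!: continuous_intros)
  define W where "W x t = \<psi> x t * (sqrt (t + 1) * exp (x\<^sup>2 / (4 * D * (t + 1)) - f\<^sub>0 * t))" for x t
  obtain Wt Wx Wxx where "strip_solution D A A' W Wt Wx Wxx"
    using strip_solution_of_dirichlet_solution[OF D assms(6,7) A_deriv A'_cont assms(15) \<psi>_nonneg]
    unfolding W_def by blast
  then interpret strip_solution D A A' W Wt Wx Wxx .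

  obtain E where "E > 0" "\<forall>\<^sub>F t in at_top. norm (\<eta> t) \<le> E * norm (1 :: real)"
    using assms(11) by (auto elim: landau_o.bigE)
  moreover have "\<forall>\<^sub>F t in at_top. norm (\<eta>' t) \<le> 1 * norm (1 / t)"
    using assms(12) by (rule landau_o.smallD) simp
  ultimately have "\<forall>\<^sub>F t in at_top. \<bar>\<eta> t\<bar> \<le> E \<and> \<bar>\<eta>' t\<bar> \<le> \<bar>1 / t\<bar>"
    by (auto elim: eventually_elim2)
  then obtain Tc where Tc: "\<And>t. t \<ge> Tc \<Longrightarrow> \<bar>\<eta> t\<bar> \<le> E \<and> \<bar>\<eta>' t\<bar> \<le> \<bar>1 / t\<bar>"
    unfolding eventually_at_top_linorder by blast
  define Ta where "Ta = max 1 Tc"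
  have Ta: "\<bar>\<eta> t\<bar> \<le> E" "\<bar>(t + 1) * \<eta>' t\<bar> \<le> 2" "t \<ge> 1" if "t \<ge> Ta" for t
  proof -
    show t1: "t \<ge> 1" "\<bar>\<eta> t\<bar> \<le> E" using that Tc[of t] by (auto simp: Ta_def)
    have "\<bar>(t + 1) * \<eta>' t\<bar> \<le> (t + 1) * (1 / t)"
      using Tc[of t] that t1 unfolding abs_mult by (intro mult_mono) (auto simp: Ta_def)
    also have "\<dots> \<le> 2" using t1 by (simp add: divide_le_eq)
    finally show "\<bar>(t + 1) * \<eta>' t\<bar> \<le> 2" .
  qed
  \<comment> \<open>The linear terms cancel up to the constant c, and (t + 1) \<eta>' is bounded by
    the decay of \<eta>'; only \<alpha> ln (t + 1) is unbounded.\<close>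
  have drift: "\<bar>A t - (t + 1) * A' t - \<alpha> * ln (t + 1)\<bar> \<le> c + E + \<alpha> + 2" if "t \<ge> Ta" for t
  proof -
    have "A t - (t + 1) * A' t - \<alpha> * ln (t + 1) = c + \<eta> t - \<alpha> - (t + 1) * \<eta>' t"
      using Ta(3)[OF that] by (simp add: A_eq A'_def field_simps)
    then show ?thesis using Ta[OF that] c \<alpha> by linarith
  qed
  obtain x0 t0 where xt0: "(x0, t0) \<in> closed_domain A L" "\<psi> x0 t0 \<noteq> 0" using assms(17) by blast
  have t0: "0 < t0" "A t0 \<le> x0" "x0 \<le> A t0 + L t0" using xt0(1) by (auto simp: closed_domain_def)
  have "A t0 + L t0 = - A t0" using assms(6)[of t0] t0 by simp
  moreover have "x0 \<noteq> A t0" "x0 \<noteq> A t0 + L t0"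
    using assms(15) xt0(2) t0 unfolding dirichlet_solution_def by metis+
  ultimately have x0: "A t0 < x0" "x0 < - A t0" using t0 by linarith+
  have "\<psi> x0 t0 > 0" using \<psi>_nonneg[OF xt0(1)] xt0(2) by simp
  then have W_pos: "W x0 t0 > 0" using t0 by (simp add: W_def)
  have Ta1: "Ta \<ge> 1" by (simp add: Ta_def)
  have A_le: "A t \<le> - c * t + \<alpha> * ln (t + 1) + E" if "t \<ge> Ta" for t
    using A_eq[of t] Ta[OF that] by auto
  obtain m M T1 where mM: "0 < m" "0 < M" "1 \<le> T1"
    "\<And>t y. t \<ge> T1 \<Longrightarrow> 0 \<le> y \<Longrightarrow> y \<le> c * (t + 1) / 4 \<Longrightarrow>
      m * (y / (t + 1)) \<le> W (A t + y) t \<and> W (A t + y) t \<le> M * (y / (t + 1))"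
    using W_boundary_asymptotics[OF c(1) \<alpha> Ta1 A_le drift t0(1) x0 W_pos] by blast

  \<comment> \<open>This bounds the offset c + \<eta> t + y; the c arises from writing - c t as - c
    \<tau> + c.\<close>
  define e1 where "e1 = c + E + Y"
  have e1: "e1 > 0" using c Y \<open>E > 0\<close> by (simp add: e1_def)
  have "\<forall>\<^sub>F t in at_top. Y \<le> c * (t + 1) / 4" using c by real_asymp
  moreover have "\<forall>\<^sub>F t in at_top. (\<alpha> * ln (t + 1) + e1)\<^sup>2 \<le> 4 * D * (t + 1)" using \<alpha> e1 D by real_asymp
  ultimately have "\<forall>\<^sub>F t in at_top. Y \<le> c * (t + 1) / 4 \<and> (\<alpha> * ln (t + 1) + e1)\<^sup>2 \<le> 4 * D * (t + 1)"
    by (rule eventually_conj)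
  then obtain Td where Td: "\<And>t. t \<ge> Td \<Longrightarrow> Y \<le> c * (t + 1) / 4 \<and> (\<alpha> * ln (t + 1) + e1)\<^sup>2 \<le> 4 * D * (t + 1)"
    unfolding eventually_at_top_linorder by blast
  define T where "T = max (max T1 Td) Ta"
  define \<Theta> where "\<Theta> = f\<^sub>0 + c * e1 / (2 * D) + 1"
  define p where "p = \<alpha> * c / (2 * D)"
  \<comment> \<open>Of the - 3/2, the part - 1 comes from W being of order y / \<tau> and - 1/2 from
    the prefactor of the Gaussian.\<close>
  define q where "q = - 3 / 2 + p"
  define \<beta>\<^sub>0 where "\<beta>\<^sub>0 = m * exp (- \<Theta>) * 2 powr (- \<bar>q\<bar>)"
  \<comment> \<open>Taking \<open>m + M\<close> instead of \<open>M\<close> gives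
    \<open>\<beta>\<^sub>0 \<le> \<beta>\<^sub>1\<close> without comparing \<open>m\<close> with
    \<open>M\<close>.\<close>
  define \<beta>\<^sub>1 where "\<beta>\<^sub>1 = (m + M) * exp \<Theta> * 2 powr \<bar>q\<bar>"
  have \<Theta>: "\<Theta> \<ge> 0" using assms(1,2) c e1 by (simp add: \<Theta>_def)
  have \<beta>: "0 < \<beta>\<^sub>0" "\<beta>\<^sub>0 \<le> \<beta>\<^sub>1"
    unfolding \<beta>\<^sub>0_def \<beta>\<^sub>1_def using mM \<Theta> by (auto intro!: mult_mono powr_mono)
  have bounds: "\<beta>\<^sub>0 * (y * t powr q) \<le> \<psi> (A t + y) t \<and> \<psi> (A t + y) t \<le> \<beta>\<^sub>1 * (y * t powr q)"
    if t: "t \<ge> T" and y: "0 \<le> y" "y \<le> Y" for t y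
  proof -
    have tt: "t \<ge> T1" "t \<ge> Td" "t \<ge> Ta" "t \<ge> 1" using t mM by (auto simp: T_def)
    define \<tau> where "\<tau> = t + 1"
    have \<tau>: "\<tau> > 0" "\<tau> \<ge> 1" using tt by (auto simp: \<tau>_def)
    define e where "e = c + \<eta> t + y"
    have e: "\<bar>e\<bar> \<le> e1" using Ta(1)[OF tt(3)] y c by (simp add: e_def e1_def)
    define r where "r = (\<alpha> * ln \<tau> + e)\<^sup>2 / (4 * D * \<tau>)"
    have r: "0 \<le> r" "r \<le> 1"
    proof -
      show "0 \<le> r" using D \<tau> by (simp add: r_def)
      have "0 \<le> \<alpha> * ln \<tau>" using \<alpha> \<tau> by simp
      then have "\<bar>\<alpha> * ln \<tau> + e\<bar> \<le> \<alpha> * ln \<tau> + e1" using e by linarith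
      then have "(\<alpha> * ln \<tau> + e)\<^sup>2 \<le> (\<alpha> * ln \<tau> + e1)\<^sup>2" by (rule abs_le_square_iff[THEN iffD1, OF order_trans]) simp
      also have "\<dots> \<le> 4 * D * \<tau>" using Td[OF tt(2)] by (simp add: \<tau>_def)
      finally show "r \<le> 1" using D \<tau> by (simp add: r_def)
    qed
    define \<theta> where "\<theta> = f\<^sub>0 - c * e / (2 * D) + r"
    have "\<bar>c * e / (2 * D)\<bar> \<le> c * e1 / (2 * D)"
      using c D e by (simp add: abs_mult divide_right_mono)
    then have \<theta>: "\<bar>\<theta>\<bar> \<le> \<Theta>" using r assms(2) unfolding \<theta>_def \<Theta>_def by linarith
    have "A t + y = - c * \<tau> + (\<alpha> * ln \<tau> + e)" using tt by (simp add: A_eq \<tau>_def e_def algebra_simps)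
    from heat_kernel_factor[OF D c(2) \<tau>(1) this]
    have "W (A t + y) t = \<psi> (A t + y) t * (\<tau> powr (1 / 2 - p) * exp \<theta>)"
      unfolding W_def p_def \<theta>_def r_def by (simp add: \<tau>_def)
    then have "W (A t + y) t * (\<tau> powr (p - 1 / 2) * exp (- \<theta>)) 
      = \<psi> (A t + y) t * ((\<tau> powr (1 / 2 - p) * \<tau> powr (p - 1 / 2)) * (exp \<theta> * exp (- \<theta>)))"
      by (simp only: mult_ac)
    also have "\<dots> = \<psi> (A t + y) t" using \<tau> by (simp add: powr_add[symmetric] exp_minus)
    finally have \<psi>: "\<psi> (A t + y) t = W (A t + y) t * (\<tau> powr (p - 1 / 2) * exp (- \<theta>))" ..
    have q: "k * (y / \<tau>) * (\<tau> powr (p - 1 / 2) * s) = k * s * (y * \<tau> powr q)" for k s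
    proof -
      have "\<tau> powr q = \<tau> powr (p - 1 / 2) / \<tau>"
        using \<tau> powr_diff[of \<tau> "p - 1 / 2" 1] by (simp add: q_def)
      then show ?thesis by simp
    qed
    have Wb: "m * (y / \<tau>) \<le> W (A t + y) t" "W (A t + y) t \<le> M * (y / \<tau>)"
      using mM(4)[OF tt(1) y(1)] Td[OF tt(2)] y unfolding \<tau>_def by auto
    have tq: "2 powr (- \<bar>q\<bar>) * t powr q \<le> \<tau> powr q" "\<tau> powr q \<le> 2 powr \<bar>q\<bar> * t powr q"
      using powr_shift_bounds[OF tt(4)] unfolding \<tau>_def by auto
    have "\<beta>\<^sub>0 * (y * t powr q) = m * exp (- \<Theta>) * (y * (2 powr (- \<bar>q\<bar>) * t powr q))"
      by (simp add: \<beta>\<^sub>0_def)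
    also have "\<dots> \<le> m * exp (- \<theta>) * (y * \<tau> powr q)"
      using mM y \<theta> tq by (intro mult_mono) auto
    also have "\<dots> = m * (y / \<tau>) * (\<tau> powr (p - 1 / 2) * exp (- \<theta>))" by (rule q[symmetric])
    also have "\<dots> \<le> \<psi> (A t + y) t" unfolding \<psi> using Wb by (intro mult_right_mono) auto
    finally have lower: "\<beta>\<^sub>0 * (y * t powr q) \<le> \<psi> (A t + y) t" .
    have "\<psi> (A t + y) t \<le> M * (y / \<tau>) * (\<tau> powr (p - 1 / 2) * exp (- \<theta>))"
      unfolding \<psi> using Wb by (intro mult_right_mono) auto
    also have "\<dots> = M * exp (- \<theta>) * (y * \<tau> powr q)" by (rule q)
    also have "\<dots> \<le> (m + M) * exp \<Theta> * (y * (2 powr \<bar>q\<bar> * t powr q))"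
      using mM y \<theta> tq by (intro mult_mono) auto
    also have "\<dots> = \<beta>\<^sub>1 * (y * t powr q)" by (simp add: \<beta>\<^sub>1_def)
    finally show ?thesis using lower by blast
  qed
  have "T > 0" using mM(3) by (simp add: T_def)
  then show "\<exists>T>0. \<exists>\<beta>\<^sub>0 \<beta>\<^sub>1. 0 < \<beta>\<^sub>0 \<and> \<beta>\<^sub>0 \<le> \<beta>\<^sub>1 \<and>
    (\<forall>t\<ge>T. \<forall>y. 0 \<le> y \<and> y \<le> Y \<longrightarrow>
       \<beta>\<^sub>0 * (y * t powr (- 3 / 2 + \<alpha> * c / (2 * D))) \<le> \<psi> (A t + y) t \<and>
       \<psi> (A t + y) t \<le> \<beta>\<^sub>1 * (y * t powr (- 3 / 2 + \<alpha> * c / (2 * D))))"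
    using \<beta> bounds unfolding q_def p_def by blast
qed

end
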